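(* Let $[x^{\mathsf T},y^{\mathsf T}]^{\mathsf T}$ be the unique solution of the generalized saddle point problem $$\mathcal M\begin{bmatrix}x\\ y\end{bmatrix}=\begin{bmatrix}A&B^{\mathsf T}\\ C&D\end{bmatrix}\begin{bmatrix}x\\ y\end{bmatrix}=\begin{bmatrix}f\\ g\end{bmatrix}=\mathbf d$$ with the structure $\mathcal L$, i.e. $A\in\mathcal L_1$, $D\in\mathcal L_2$, $B,C\in\mathbb R^{n\times m}$, and let $\mathbf L\in\mathbb R^{k\times(m+n)}$. Then the structured normwise, mixed and componentwise condition numbers of the linear function $\mathbf L[x^{\mathsf T},y^{\mathsf T}]^{\mathsf T}$ are, respectively, $$\mathscr K(\mathbf L[x^{\mathsf T},y^{\mathsf T}]^{\mathsf T};\mathcal L)=\frac{\left\|\mathbf L\mathcal M^{-1}\begin{bmatrix}\mathcal H\Phi_{\mathcal L}\mathfrak D_{\mathcal L}^{-1}&-I_{m+n}\end{bmatrix}\right\|_2\left\|\begin{bmatrix}\mathcal M&\mathbf d\end{bmatrix}\right\|_F}{\left\|\mathbf L[x^{\mathsf T},y^{\mathsf T}]^{\mathsf T}\right\|_2},$$ $$\mathscr M(\mathbf L[x^{\mathsf T},y^{\mathsf T}]^{\mathsf T};\mathcal L)=\frac{\left\||\mathbf L\mathcal M^{-1}\mathcal H\Phi_{\mathcal L}|\begin{bmatrix}\mathrm{vec}_{\mathcal L_1}(|A|)\\ \mathrm{vec}(|B|)\\ \mathrm{vec}(|C|)\\ \mathrm{vec}_{\mathcal L_2}(|D|)\end{bmatrix}+|\mathbf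 L\mathcal M^{-1}|\begin{bmatrix}|f|\\ |g|\end{bmatrix}\right\|_\infty}{\left\|\mathbf L[x^{\mathsf T},y^{\mathsf T}]^{\mathsf T}\right\|_\infty},$$ $$\mathscr C(\mathbf L[x^{\mathsf T},y^{\mathsf T}]^{\mathsf T};\mathcal L)=\left\|\mathbf D^{\dagger}_{\mathbf L[x^{\mathsf T},y^{\mathsf T}]^{\mathsf T}}|\mathbf L\mathcal M^{-1}\mathcal H\Phi_{\mathcal L}|\begin{bmatrix}\mathrm{vec}_{\mathcal L_1}(|A|)\\ \mathrm{vec}(|B|)\\ \mathrm{vec}(|C|)\\ \mathrm{vec}_{\mathcal L_2}(|D|)\end{bmatrix}+\mathbf D^{\dagger}_{\mathbf L[x^{\mathsf T},y^{\mathsf T}]^{\mathsf T}}|\mathbf L\mathcal M^{-1}|\begin{bmatrix}|f|\\ |g|\end{bmatrix}\right\|_\infty .$$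
   Context: Notation: $\|\cdot\|_2$ is the Euclidean norm of a vector / spectral norm of a matrix, $\|\cdot\|_\infty$ the infinity norm, $\|\cdot\|_F$ the Frobenius norm. $|X|$ is the entrywise absolute value, and $X\le Y$ for matrices is entrywise. $\mathrm{vec}$ stacks columns, $\otimes$ is the Kronecker product. For a vector $v$, $\mathbf D_v$ is the diagonal matrix with diagonal $v$; $\dagger$ is the Moore-Penrose inverse. Quotients of vectors are entrywise, with $0/0=0$ and $a/0=\infty$ for $a\ne0$. Setting and standing assumptions: $x,f\in\mathbb R^m$, $y,g\in\mathbb R^n$; $A\in\mathbb R^{m\times m}$ and $\mathcal M$ are nonsingular. It is assumed that $[x^{\mathsf T},y^{\mathsf T}]^{\mathsf T}\ne\mathbf 0$ for the mixed condition number and that all $x_i\ne0$ and $y_i\ne0$ for the componentwise one; moreover, as required for the condition numbers to be defined, $\mathbf L[x^{\mathsf T},y^{\mathsf T}]^{\mathsf T}\ne\mathbf 0$, with all entries nonzero in the componentwise case. Put $$\mathcal H=\begin{bmatrix}x^{\mathsf T}\otimes I_m&I_m\otimes y^{\mathsf T}&\mathbf 0&\mathbf 0\\ \mathbf 0&\mathbf 0&x^{\mathsf T}\otimes I_n&y^{\mathsf T}\otimes I_n\end{bmatrix}.$$ Linear structures: $\mathcal L_1\subseteq\mathbb R^{m\times m}$ and $\mathcal L_2\subseteq\mathbb R^{n\times n}$ are two distinct linear subspaces (containing different classes of structured matrices), with $\dim\mathcal L_1=p$, $\dim\mathcal L_2=s$ and bases $\{E_i\}_{i=1}^p$ and $\{F_i\}_{i=1}^s$.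 For $A=\sum_i a_iE_i\in\mathcal L_1$ and $D=\sum_id_iF_i\in\mathcal L_2$ put $\mathrm{vec}_{\mathcal L_1}(A)=[a_1,\dots,a_p]^{\mathsf T}$, $\mathrm{vec}_{\mathcal L_2}(D)=[d_1,\dots,d_s]^{\mathsf T}$; the symbols $\mathrm{vec}_{\mathcal L_1}(|A|)$ and $\mathrm{vec}_{\mathcal L_2}(|D|)$ denote $|\mathrm{vec}_{\mathcal L_1}(A)|$ and $|\mathrm{vec}_{\mathcal L_2}(D)|$. $\Phi_{\mathcal L_1}=[\mathrm{vec}(E_1),\dots,\mathrm{vec}(E_p)]\in\mathbb R^{m^2\times p}$, $\Phi_{\mathcal L_2}=[\mathrm{vec}(F_1),\dots,\mathrm{vec}(F_s)]\in\mathbb R^{n^2\times s}$. For $j=1,2$, $\mathfrak D_{\mathcal L_j}$ is the diagonal matrix with diagonal entries $\mathfrak D_{\mathcal L_j}(i,i)=\|\Phi_{\mathcal L_j}(:,i)\|_2$, such that $\|A\|_F=\|\mathfrak D_{\mathcal L_1}\mathrm{vec}_{\mathcal L_1}(A)\|_2$ and $\|D\|_F=\|\mathfrak D_{\mathcal L_2}\mathrm{vec}_{\mathcal L_2}(D)\|_2$. $\Phi_{\mathcal L}=\mathrm{diag}(\Phi_{\mathcal L_1},I_{2mn},\Phi_{\mathcal L_2})$, $\mathfrak D_{\mathcal L}=\mathrm{diag}(\mathfrak D_{\mathcal L_1},I_{2mn},\mathfrak D_{\mathcal L_2})$ (block diagonal). $\mathcal L=\left\{\begin{bmatrix}A&B^{\mathsf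 T}\\ C&D\end{bmatrix}:A\in\mathcal L_1,\ B,C\in\mathbb R^{n\times m},\ D\in\mathcal L_2\right\}$. For perturbations $\Delta\mathcal M=\begin{bmatrix}\Delta A&\Delta B^{\mathsf T}\\ \Delta C&\Delta D\end{bmatrix}$ and $\Delta\mathbf d=\begin{bmatrix}\Delta f\\ \Delta g\end{bmatrix}$, write $z=[x^{\mathsf T},y^{\mathsf T}]^{\mathsf T}$ and let $z+\Delta z$, $\Delta z=[\Delta x^{\mathsf T},\Delta y^{\mathsf T}]^{\mathsf T}$, be the unique solution (for small perturbations) of $(\mathcal M+\Delta\mathcal M)(z+\Delta z)=\mathbf d+\Delta\mathbf d$. Structured condition numbers: $$\mathscr K(\mathbf Lz;\mathcal L)=\lim_{\eta\to0}\sup\left\{\frac{\|\mathbf L\Delta z\|_2}{\eta\|\mathbf Lz\|_2}:\|[\Delta\mathcal M\ \ \Delta\mathbf d]\|_F\le\eta\|[\mathcal M\ \ \mathbf d]\|_F,\ \Delta\mathcal M\in\mathcal L\right\},$$ $$\mathscr M(\mathbf Lz;\mathcal L)=\lim_{\eta\to0}\sup\left\{\frac{\|\mathbf L\Delta z\|_\infty}{\eta\|\mathbf Lz\|_\infty}:|[\Delta\mathcal M\ \ \Delta\mathbf d]|\le\eta|[\mathcal M\ \ \mathbf d]|,\ \Delta\mathcal M\in\mathcal L\right\},$$ $$\mathscr C(\mathbf Lz;\mathcal L)=\lim_{\eta\to0}\sup\left\{\frac1\eta\left\|\frac{\mathbf L\Delta z}{\mathbf Lz}\right\|_\infty:|[\Delta\mathcal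 M\ \ \Delta\mathbf d]|\le\eta|[\mathcal M\ \ \mathbf d]|,\ \Delta\mathcal M\in\mathcal L\right\}.$$
   Formalization: The mixed and componentwise formulas are stated for bases {E_i}, {F_i} with |A| = Σ|a_i||E_i| on L_1 and |D| = Σ|d_i||F_i| on L_2 (basis matrices with disjoint supports); for overlapping bases, such as I, diag(1,−1), they fail. *)

theory Defs
  imports "HOL-Analysis.Analysis"
begin

text \<open>
  The type \<^typ>\<open>real^'c^'r\<close> is the type of matrices with rows indexed by \<open>'r\<close> and columns
  indexed by \<open>'c\<close>.  Partitioned vectors and matrices are indexed by sum types, the columns of a
  Kronecker product and the entries of a vectorised matrix by product types.  The norm of
  \<^typ>\<open>real^'c^'r\<close> is the square root of the sum of all squared entries, i.e. the Frobenius norm.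
  The absolute value and \<open>\<le>\<close> are entrywise on vectors and on matrices.
\<close>

abbreviation frobenius_norm :: "real^'c^'r \<Rightarrow> real" where
  "frobenius_norm X \<equiv> norm X"

definition spectral_norm :: "real^'c^'r \<Rightarrow> real" where
  "spectral_norm X = onorm (\<lambda>v. X *v v)"

definition hstack :: "real^'a^'r \<Rightarrow> real^'b^'r \<Rightarrow> real^('a + 'b)^'r" where
  "hstack X Y = (\<chi> i j. case j of Inl a \<Rightarrow> X $ i $ a | Inr b \<Rightarrow> Y $ i $ b)"

text \<open>Used both for vectors (\<open>'e = real\<close>) and for matrices, which are vectors of rows.\<close>

definition vstack :: "'e^'a \<Rightarrow> 'e^'b \<Rightarrow> 'e^('a + 'b)" where
  "vstack X Y = (\<chi> i. case i of Inl a \<Rightarrow> X $ a | Inr b \<Rightarrow> Y $ b)"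

definition block_diag :: "real^'a^'r \<Rightarrow> real^'b^'s \<Rightarrow> real^('a + 'b)^('r + 's)" where
  "block_diag X Y = vstack (hstack X 0) (hstack 0 Y)"

definition diag_matrix :: "real^'a \<Rightarrow> real^'a^'a" where
  "diag_matrix v = (\<chi> i j. if i = j then v $ i else 0)"

text \<open>Stacking the columns: the index \<open>(j, i)\<close> stands for row \<open>i\<close> of column \<open>j\<close>.\<close>

definition vec_stack :: "real^'c^'r \<Rightarrow> real^('c \<times> 'r)" where
  "vec_stack X = (\<chi> k. X $ snd k $ fst k)"

definition kronecker :: "real^'b^'a \<Rightarrow> real^'d^'c \<Rightarrow> real^('b \<times> 'd)^('a \<times> 'c)" where
  "kronecker X Y = (\<chi> i j. X $ fst i $ fst j * Y $ snd i $ snd j)"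

text \<open>The Moore-Penrose inverse, characterised by the four Penrose equations.\<close>

definition mp_inverse :: "real^'c^'r \<Rightarrow> real^'r^'c" where
  "mp_inverse X = (THE Y. X ** Y ** X = X \<and> Y ** X ** Y = Y \<and>
     transpose (X ** Y) = X ** Y \<and> transpose (Y ** X) = Y ** X)"

text \<open>
  Infinity norm of the entrywise quotient, with \<open>0/0 = 0\<close> and \<open>a/0 = \<infinity>\<close> for \<open>a \<noteq> 0\<close>.
\<close>

definition entry_quot :: "real \<Rightarrow> real \<Rightarrow> ereal" where
  "entry_quot a b = (if b = 0 then (if a = 0 then 0 else \<infinity>) else ereal (a / b))"

definition infnorm_quot :: "real^'k \<Rightarrow> real^'k \<Rightarrow> ereal" where
  "infnorm_quot u w = (SUP i. \<bar>entry_quot (u $ i) (w $ i)\<bar>)"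


definition saddle_matrix ::
    "real^'m^'m \<Rightarrow> real^'m^'n \<Rightarrow> real^'m^'n \<Rightarrow> real^'n^'n \<Rightarrow> real^('m + 'n)^('m + 'n)" where
  "saddle_matrix A B C D = vstack (hstack A (transpose B)) (hstack C D)"

definition augmented :: "real^'l^'l \<Rightarrow> real^'l \<Rightarrow> real^('l + 1)^'l" where
  "augmented M d = hstack M (columnvector d)"

text \<open>
  The rows of \<open>x\<^sup>T \<otimes> I\<close> and \<open>I \<otimes> y\<^sup>T\<close> are indexed by \<open>1 \<times> 'r\<close> and \<open>'r \<times> 1\<close>; both are identified with
  \<open>'r\<close>.  The column blocks of \<open>saddle_H x y\<close> belong, in this order, to \<open>vec A\<close>, \<open>vec B\<close>, \<open>vec C\<close>
  and \<open>vec D\<close>.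
\<close>

definition row_kron_id :: "real^'a \<Rightarrow> real^('a \<times> 'r)^'r" where
  "row_kron_id x = (\<chi> i. kronecker (rowvector x :: real^'a^1) (mat 1 :: real^'r^'r) $ (1, i))"

definition id_kron_row :: "real^'b \<Rightarrow> real^('r \<times> 'b)^'r" where
  "id_kron_row y = (\<chi> i. kronecker (mat 1 :: real^'r^'r) (rowvector y :: real^'b^1) $ (i, 1))"

definition saddle_H :: "real^'m \<Rightarrow> real^'n \<Rightarrow>
    real^(('m \<times> 'm) + ((('m \<times> 'n) + ('m \<times> 'n)) + ('n \<times> 'n)))^('m + 'n)" where
  "saddle_H x y = vstack
     (hstack (row_kron_id x) (hstack (hstack (id_kron_row y) 0) 0))
     (hstack 0 (hstack (hstack 0 (row_kron_id x)) (row_kron_id y)))"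


text \<open>
  A basis of a space of structured matrices is a family \<open>E\<^sub>i\<close>, \<open>i \<in> P\<close>, where \<open>P\<close> is a subset of a
  finite index type.  Using a subset makes the empty basis (of the zero space, e.g. for \<open>D = 0\<close>)
  available, since types are nonempty.  Indices outside \<open>P\<close> are padding: they have coordinate 0,
  a zero column in \<open>struct_Phi\<close> and diagonal entry 1 in \<open>struct_D\<close> (which keeps it invertible).
  For \<open>P = UNIV\<close> there is no padding.
\<close>

definition is_basis :: "'p set \<Rightarrow> ('p \<Rightarrow> real^'c^'r) \<Rightarrow> (real^'c^'r) set \<Rightarrow> bool" where
  "is_basis P E V \<longleftrightarrow> inj_on E P \<and> independent (E ` P) \<and> span (E ` P) = V"

definition struct_vec :: "'p::finite set \<Rightarrow> ('p \<Rightarrow> real^'c^'r) \<Rightarrow> real^'c^'r \<Rightarrow> real^'p" where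
  "struct_vec P E X = (THE a. X = (\<Sum>i\<in>P. a $ i *\<^sub>R E i) \<and> (\<forall>i. i \<notin> P \<longrightarrow> a $ i = 0))"

definition struct_Phi :: "'p::finite set \<Rightarrow> ('p \<Rightarrow> real^'c^'r) \<Rightarrow> real^'p^('c \<times> 'r)" where
  "struct_Phi P E = (\<chi> k i. if i \<in> P then vec_stack (E i) $ k else 0)"

definition struct_D :: "'p::finite set \<Rightarrow> ('p \<Rightarrow> real^'c^'r) \<Rightarrow> real^'p^'p" where
  "struct_D P E = diag_matrix (\<chi> i. if i \<in> P then norm (column i (struct_Phi P E)) else 1)"

text \<open>
  The identity \<open>\<parallel>X\<parallel>\<^sub>F = \<parallel>\<DD> vec(X)\<parallel>\<^sub>2\<close> on the structured space, which depends on the chosen basis.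
\<close>

definition frobenius_compatible ::
    "'p::finite set \<Rightarrow> ('p \<Rightarrow> real^'c^'r) \<Rightarrow> (real^'c^'r) set \<Rightarrow> bool" where
  "frobenius_compatible P E V \<longleftrightarrow>
     (\<forall>X\<in>V. frobenius_norm X = norm (struct_D P E *v struct_vec P E X))"

text \<open>
  The meaning of the convention that \<open>vec(|X|)\<close> denotes \<open>|vec(X)|\<close>: the entrywise absolute value of
  a structured matrix is obtained by taking absolute values of its coordinates (and of the basis
  matrices, which may have negative entries, as for skew-symmetric matrices).  Equivalently, the
  basis matrices have pairwise disjoint supports, as the standard bases of the symmetric, Toeplitz,
  Hankel, circulant, diagonal and similar classes do.
\<close>

definition abs_compatible ::
    "'p::finite set \<Rightarrow> ('p \<Rightarrow> real^'c^'r) \<Rightarrow> (real^'c^'r) set \<Rightarrow> bool" where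
  "abs_compatible P E V \<longleftrightarrow> (\<forall>X\<in>V. \<bar>X\<bar> = (\<Sum>i\<in>P. \<bar>struct_vec P E X\<bar> $ i *\<^sub>R \<bar>E i\<bar>))"

definition saddle_struct ::
    "(real^'m^'m) set \<Rightarrow> (real^'n^'n) set \<Rightarrow> (real^('m + 'n)^('m + 'n)) set" where
  "saddle_struct L1 L2 = {saddle_matrix A B C D | A B C D. A \<in> L1 \<and> D \<in> L2}"

definition saddle_Phi ::
    "'p::finite set \<Rightarrow> ('p \<Rightarrow> real^'m^'m) \<Rightarrow> 's::finite set \<Rightarrow> ('s \<Rightarrow> real^'n^'n) \<Rightarrow>
     real^('p + ((('m \<times> 'n) + ('m \<times> 'n)) + 's))
         ^(('m \<times> 'm) + ((('m \<times> 'n) + ('m \<times> 'n)) + ('n \<times> 'n)))" where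
  "saddle_Phi P E S F = block_diag (struct_Phi P E) (block_diag (mat 1) (struct_Phi S F))"

definition saddle_D ::
    "'p::finite set \<Rightarrow> ('p \<Rightarrow> real^'m^'m) \<Rightarrow> 's::finite set \<Rightarrow> ('s \<Rightarrow> real^'n^'n) \<Rightarrow>
     real^('p + ((('m \<times> 'n) + ('m \<times> 'n)) + 's))^('p + ((('m \<times> 'n) + ('m \<times> 'n)) + 's))" where
  "saddle_D P E S F = block_diag (struct_D P E) (block_diag (mat 1) (struct_D S F))"

definition saddle_absvec ::
    "'p::finite set \<Rightarrow> ('p \<Rightarrow> real^'m^'m) \<Rightarrow> 's::finite set \<Rightarrow> ('s \<Rightarrow> real^'n^'n) \<Rightarrow>
     real^'m^'m \<Rightarrow> real^'m^'n \<Rightarrow> real^'m^'n \<Rightarrow> real^'n^'n \<Rightarrow>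
     real^('p + ((('m \<times> 'n) + ('m \<times> 'n)) + 's))" where
  "saddle_absvec P E S F A B C D =
     vstack \<bar>struct_vec P E A\<bar>
       (vstack (vstack (vec_stack \<bar>B\<bar>) (vec_stack \<bar>C\<bar>)) \<bar>struct_vec S F D\<bar>)"


text \<open>\<open>z + dz\<close> is the unique solution of the perturbed system.\<close>

definition perturbed_solution ::
    "real^'l^'l \<Rightarrow> real^'l \<Rightarrow> real^'l \<Rightarrow> real^'l^'l \<Rightarrow> real^'l \<Rightarrow> real^'l \<Rightarrow> bool" where
  "perturbed_solution M d z dM dd dz \<longleftrightarrow> invertible (M + dM) \<and> (M + dM) *v (z + dz) = d + dd"

text \<open>
  Suprema over all admissible perturbations of size \<open>\<eta>\<close>, in the extended reals because they may be
  infinite when \<open>\<eta>\<close> is not small.  The condition numbers are their limits as \<open>\<eta>\<close> tends to 0 from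
  above.
\<close>

definition normwise_sup ::
    "(real^'l^'l) set \<Rightarrow> real^'l^'k \<Rightarrow> real^'l^'l \<Rightarrow> real^'l \<Rightarrow> real^'l \<Rightarrow> real \<Rightarrow> ereal" where
  "normwise_sup LL K M d z \<eta> = Sup {ereal (norm (K *v dz) / (\<eta> * norm (K *v z))) | dM dd dz.
     frobenius_norm (augmented dM dd) \<le> \<eta> * frobenius_norm (augmented M d) \<and> dM \<in> LL \<and>
     perturbed_solution M d z dM dd dz}"

definition mixed_sup ::
    "(real^'l^'l) set \<Rightarrow> real^'l^'k \<Rightarrow> real^'l^'l \<Rightarrow> real^'l \<Rightarrow> real^'l \<Rightarrow> real \<Rightarrow> ereal" where
  "mixed_sup LL K M d z \<eta> = Sup {ereal (infnorm (K *v dz) / (\<eta> * infnorm (K *v z))) | dM dd dz.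
     \<bar>augmented dM dd\<bar> \<le> \<eta> *\<^sub>R \<bar>augmented M d\<bar> \<and> dM \<in> LL \<and>
     perturbed_solution M d z dM dd dz}"

definition componentwise_sup ::
    "(real^'l^'l) set \<Rightarrow> real^'l^'k \<Rightarrow> real^'l^'l \<Rightarrow> real^'l \<Rightarrow> real^'l \<Rightarrow> real \<Rightarrow> ereal" where
  "componentwise_sup LL K M d z \<eta> = Sup {ereal (1 / \<eta>) * infnorm_quot (K *v dz) (K *v z) | dM dd dz.
     \<bar>augmented dM dd\<bar> \<le> \<eta> *\<^sub>R \<bar>augmented M d\<bar> \<and> dM \<in> LL \<and>
     perturbed_solution M d z dM dd dz}"

definition normwise_cond ::
    "(real^'l^'l) set \<Rightarrow> real^'l^'k \<Rightarrow> real^'l^'l \<Rightarrow> real^'l \<Rightarrow> real^'l \<Rightarrow> ereal" where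
  "normwise_cond LL K M d z = Lim (at_right 0) (normwise_sup LL K M d z)"

definition mixed_cond ::
    "(real^'l^'l) set \<Rightarrow> real^'l^'k \<Rightarrow> real^'l^'l \<Rightarrow> real^'l \<Rightarrow> real^'l \<Rightarrow> ereal" where
  "mixed_cond LL K M d z = Lim (at_right 0) (mixed_sup LL K M d z)"

definition componentwise_cond ::
    "(real^'l^'l) set \<Rightarrow> real^'l^'k \<Rightarrow> real^'l^'l \<Rightarrow> real^'l \<Rightarrow> real^'l \<Rightarrow> ereal" where
  "componentwise_cond LL K M d z = Lim (at_right 0) (componentwise_sup LL K M d z)"

end

theory Submission
  imports Defs
begin

text \<open>
  Write an admissible perturbation as \<open>(\<eta> U, \<eta> u)\<close> and the resulting change of the solution as
  \<open>\<eta> w\<close>.  Then \<open>M w = u - U z - \<eta> U w\<close>, so that \<open>w\<close> tends to \<open>M\<^sup>-\<^sup>1 (u - U z)\<close> as \<open>\<eta>\<close> tends to 0,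
  uniformly over the bounded set of all \<open>(U, u)\<close>, which does not depend on \<open>\<eta>\<close>.  By
  \<open>condition_number_limit\<close> each condition number is therefore the supremum of a seminorm of
  \<open>K M\<^sup>-\<^sup>1 (u - U z)\<close> over that set, and it remains to compute this supremum.

  In coordinates \<open>v\<close> of the structured matrix \<open>U\<close> one has \<open>U z = H \<Phi> v\<close>
  (\<open>saddle_H_Phi_mult\<close>), so the problem is linear in \<open>(v, u)\<close>.  For the normwise number
  the Frobenius norm of \<open>[U u]\<close> is the Euclidean norm of \<open>(\<DD> v, u)\<close>, and the supremum is an
  operator norm (\<open>normwise_linearised_sup\<close>).  For the other two, compatibility with absolute
  values forces the basis matrices to have disjoint supports
  (\<open>abs_compatible_disjoint_supports\<close>); the entrywise bound on \<open>U\<close> is then the same as the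
  entrywise bound on its coordinates, and the supremum over this box is attained by choosing signs
  (\<open>entrywise_linearised_sup\<close>).  The mixed and the componentwise number differ only in the
  weights given to the entries of \<open>K w\<close>.
\<close>

section \<open>Partitioned vectors and matrices\<close>

lemma sum_UNIV_sum_type:
  "(\<Sum>i\<in>(UNIV :: ('a::finite + 'b::finite) set). h i)
     = (\<Sum>i\<in>UNIV. h (Inl i)) + (\<Sum>i\<in>UNIV. h (Inr i))"
  by (simp flip: UNIV_Plus_UNIV add: sum.Plus)

lemma sum_UNIV_prod_type:
  "(\<Sum>i\<in>(UNIV :: ('a::finite \<times> 'b::finite) set). h i) = (\<Sum>i\<in>UNIV. \<Sum>j\<in>UNIV. h (i, j))"
  by (simp flip: UNIV_Times_UNIV add: sum.cartesian_product')

lemma vstack_Inl [simp]: "vstack X Y $ Inl i = X $ i"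
  and vstack_Inr [simp]: "vstack X Y $ Inr j = Y $ j"
  by (simp_all add: vstack_def)

lemma hstack_Inl [simp]: "hstack X Y $ i $ Inl j = X $ i $ j"
  and hstack_Inr [simp]: "hstack X Y $ i $ Inr l = Y $ i $ l"
  by (simp_all add: hstack_def)

lemma all_sum_type: "(\<forall>i :: 'a + 'b. Q i) \<longleftrightarrow> (\<forall>i. Q (Inl i)) \<and> (\<forall>i. Q (Inr i))"
  by (metis sum.exhaust)

lemma vstack_cases: obtains p q where "v = vstack p q"
proof
  show "v = vstack (\<chi> i. v $ Inl i) (\<chi> i. v $ Inr i)"
    by (simp add: vec_eq_iff all_sum_type)
qed

lemma vec_stack_cases: obtains X where "v = vec_stack X"
proof
  show "v = vec_stack (\<chi> i j. v $ (j, i))"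
    by (simp add: vec_stack_def vec_eq_iff)
qed

lemma vstack_mult_vec: "vstack X Y *v v = vstack (X *v v) (Y *v v)"
  by (simp add: vec_eq_iff all_sum_type matrix_vector_mult_def)

lemma hstack_mult_vstack: "hstack X Y *v vstack p q = X *v p + Y *v q"
  by (simp add: vec_eq_iff matrix_vector_mult_def sum_UNIV_sum_type)

lemma block_diag_mult_vstack: "block_diag X Y *v vstack p q = vstack (X *v p) (Y *v q)"
  by (simp add: block_diag_def vstack_mult_vec hstack_mult_vstack)

lemma vstack_eq_0_iff: "vstack p q = 0 \<longleftrightarrow> p = 0 \<and> q = 0"
  by (simp add: vec_eq_iff all_sum_type)

lemma abs_vstack: "\<bar>vstack p q\<bar> = vstack \<bar>p\<bar> \<bar>q\<bar>" for p q :: "real^_"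
  by (simp add: vec_eq_iff all_sum_type abs_vec_def)

lemma norm_vec_power2: "(norm v)\<^sup>2 = (\<Sum>i\<in>UNIV. (norm (v $ i))\<^sup>2)"
  by (simp add: norm_vec_def L2_set_def sum_nonneg)

lemma norm_vstack_power2: "(norm (vstack p q))\<^sup>2 = (norm p)\<^sup>2 + (norm q)\<^sup>2"
  by (simp add: norm_vec_power2 sum_UNIV_sum_type)

lemma norm_hstack_power2: "(norm (hstack X Y))\<^sup>2 = (norm X)\<^sup>2 + (norm Y)\<^sup>2"
  by (simp add: norm_vec_power2 sum_UNIV_sum_type sum.distrib)

lemma norm_transpose_power2: "(norm (transpose X))\<^sup>2 = (norm X)\<^sup>2" for X :: "real^'c^'r"
  unfolding norm_vec_power2 transpose_def by (simp, subst sum.swap) simp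

lemma norm_vec_stack_power2: "(norm (vec_stack X))\<^sup>2 = (norm X)\<^sup>2"
  unfolding norm_vec_power2 vec_stack_def sum_UNIV_prod_type
  by (simp, subst sum.swap) simp

lemma norm_columnvector_power2: "(norm (columnvector d :: real^1^'l))\<^sup>2 = (norm d)\<^sup>2"
  by (simp add: norm_vec_power2 columnvector_def)

lemma norm_augmented_power2: "(norm (augmented M d))\<^sup>2 = (norm M)\<^sup>2 + (norm d)\<^sup>2"
  by (simp add: augmented_def norm_hstack_power2 norm_columnvector_power2)

lemma norm_saddle_matrix_power2:
  "(norm (saddle_matrix A B C D))\<^sup>2 = (norm A)\<^sup>2 + (norm B)\<^sup>2 + (norm C)\<^sup>2 + (norm D)\<^sup>2"
  by (simp add: saddle_matrix_def norm_vstack_power2 norm_hstack_power2 norm_transpose_power2)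

lemma saddle_matrix_mult_vstack:
  "saddle_matrix A B C D *v vstack x y = vstack (A *v x + transpose B *v y) (C *v x + D *v y)"
  by (simp add: saddle_matrix_def vstack_mult_vec hstack_mult_vstack)

lemma abs_augmented_le_iff:
  "\<bar>augmented U u\<bar> \<le> \<bar>augmented M d\<bar> \<longleftrightarrow> \<bar>U\<bar> \<le> \<bar>M\<bar> \<and> \<bar>u\<bar> \<le> \<bar>d\<bar>"
  by (auto simp: less_eq_vec_def abs_vec_def augmented_def all_sum_type columnvector_def)

lemma augmented_scaleR: "augmented (c *\<^sub>R M) (c *\<^sub>R d) = c *\<^sub>R augmented M d"
  by (simp add: vec_eq_iff augmented_def all_sum_type columnvector_def)

lemma row_kron_id_mult_vec_stack: "row_kron_id x *v vec_stack A = A *v x"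
  unfolding vec_eq_iff row_kron_id_def kronecker_def vec_stack_def matrix_vector_mult_def
  by (simp add: sum_UNIV_prod_type rowvector_def mat_def if_distrib if_distribR sum.delta mult_ac
      cong: if_cong)

lemma id_kron_row_mult_vec_stack: "id_kron_row y *v vec_stack B = transpose B *v y"
proof -
  have *: "(\<Sum>j\<in>UNIV. \<Sum>b\<in>UNIV. (if i = j then 1 else 0) * y $ b * B $ b $ j)
          = (\<Sum>j\<in>UNIV. if i = j then (\<Sum>b\<in>UNIV. B $ b $ j * y $ b) else 0)" for i
    by (rule sum.cong) (auto simp: mult.commute)
  show ?thesis
    unfolding vec_eq_iff id_kron_row_def kronecker_def vec_stack_def matrix_vector_mult_def
    by (simp add: sum_UNIV_prod_type rowvector_def mat_def transpose_def *)
qed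

lemma saddle_H_mult:
  "saddle_H x y *v vstack (vec_stack A) (vstack (vstack (vec_stack B) (vec_stack C)) (vec_stack D))
     = saddle_matrix A B C D *v vstack x y"
  by (simp add: saddle_H_def vstack_mult_vec hstack_mult_vstack row_kron_id_mult_vec_stack
      id_kron_row_mult_vec_stack saddle_matrix_mult_vstack)

lemma diag_matrix_mult_vec: "(diag_matrix c *v v) $ i = c $ i * v $ i"
  by (simp add: diag_matrix_def matrix_vector_mult_def if_distrib if_distribR cong: if_cong)

lemma mp_inverse_diag_matrix:
  assumes "\<And>i. c $ i \<noteq> 0"
  shows "mp_inverse (diag_matrix c) = diag_matrix (\<chi> i. inverse (c $ i))"
proof -
  let ?X = "diag_matrix c" and ?Y = "diag_matrix (\<chi> i. inverse (c $ i))"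
  have XY: "?X ** ?Y = mat 1"
    by (auto simp: matrix_eq vec_eq_iff diag_matrix_mult_vec assms simp flip: matrix_vector_mul_assoc)
  have YX: "?Y ** ?X = mat 1"
    by (auto simp: matrix_eq vec_eq_iff diag_matrix_mult_vec assms simp flip: matrix_vector_mul_assoc)
  show ?thesis
    unfolding mp_inverse_def
  proof (rule the_equality)
    fix Y assume "?X ** Y ** ?X = ?X \<and> Y ** ?X ** Y = Y \<and>
      transpose (?X ** Y) = ?X ** Y \<and> transpose (Y ** ?X) = Y ** ?X"
    \<comment> \<open>for an invertible matrix the first Penrose equation alone determines \<open>Y\<close>\<close>
    then have "?Y ** (?X ** Y ** ?X) ** ?Y = ?Y ** ?X ** ?Y" by simp
    then have "(?Y ** ?X) ** Y ** (?X ** ?Y) = (?Y ** ?X) ** ?Y"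
      by (simp only: matrix_mul_assoc)
    then show "Y = ?Y" by (simp add: XY YX)
  qed (simp add: XY YX transpose_mat)
qed

section \<open>Coordinates of structured matrices\<close>

lemma struct_vec_eqI:
  assumes bas: "is_basis P E V" and a: "\<And>i. i \<notin> P \<Longrightarrow> a $ i = 0"
  shows "struct_vec P E (\<Sum>i\<in>P. a $ i *\<^sub>R E i) = a"
  unfolding struct_vec_def
proof (rule the_equality)
  fix b assume b: "(\<Sum>i\<in>P. a $ i *\<^sub>R E i) = (\<Sum>i\<in>P. b $ i *\<^sub>R E i) \<and> (\<forall>i. i \<notin> P \<longrightarrow> b $ i = 0)"
  have inj: "inj_on E P" and ind: "independent (E ` P)"
    using bas by (auto simp: is_basis_def)
  define u where "u X = b $ the_inv_into P E X - a $ the_inv_into P E X" for X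
  have "(\<Sum>X\<in>E ` P. u X *\<^sub>R X) = (\<Sum>i\<in>P. (b $ i - a $ i) *\<^sub>R E i)"
    by (subst sum.reindex[OF inj]) (auto intro!: sum.cong simp: u_def the_inv_into_f_f[OF inj])
  also have "\<dots> = 0"
    using b by (simp add: scaleR_diff_left sum_subtractf)
  finally have 0: "(\<Sum>X\<in>E ` P. u X *\<^sub>R X) = 0" .
  have "b $ i = a $ i" if "i \<in> P" for i
    using independentD[OF ind _ order_refl 0, of "E i"] that
    by (simp add: u_def the_inv_into_f_f[OF inj])
  then show "b = a"
    using a b by (metis vec_eq_iff)
qed (use a in auto)

lemma struct_vec_expansion:
  assumes bas: "is_basis P E V" and X: "X \<in> V"
  shows "(\<Sum>i\<in>P. struct_vec P E X $ i *\<^sub>R E i) = X"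
    and "i \<notin> P \<Longrightarrow> struct_vec P E X $ i = 0"
proof -
  have inj: "inj_on E P" and "X \<in> span (E ` P)"
    using assms by (auto simp: is_basis_def)
  then obtain u where "X = (\<Sum>Y\<in>E ` P. u Y *\<^sub>R Y)"
    by (auto simp: span_finite)
  then have *: "X = (\<Sum>i\<in>P. (\<chi> i. if i \<in> P then u (E i) else 0) $ i *\<^sub>R E i)"
    by (simp add: sum.reindex[OF inj])
  have "struct_vec P E X = (\<chi> i. if i \<in> P then u (E i) else 0)"
    by (subst *, rule struct_vec_eqI[OF bas]) auto
  then show "(\<Sum>i\<in>P. struct_vec P E X $ i *\<^sub>R E i) = X" "i \<notin> P \<Longrightarrow> struct_vec P E X $ i = 0"
    using * by auto
qed

lemma struct_Phi_mult: "struct_Phi P E *v v = vec_stack (\<Sum>i\<in>P. v $ i *\<^sub>R E i)"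
proof -
  have "(\<Sum>i\<in>UNIV. (if i \<in> P then vec_stack (E i) $ k else 0) * v $ i)
        = (\<Sum>i\<in>P. v $ i * vec_stack (E i) $ k)" for k
    by (rule sum.mono_neutral_cong_right) (auto simp: mult_ac)
  then show ?thesis
    by (simp add: vec_eq_iff matrix_vector_mult_def struct_Phi_def vec_stack_def)
qed

lemma struct_Phi_mult_struct_vec:
  "is_basis P E V \<Longrightarrow> X \<in> V \<Longrightarrow> struct_Phi P E *v struct_vec P E X = vec_stack X"
  by (simp add: struct_Phi_mult struct_vec_expansion)

lemma struct_vec_surj:
  assumes bas: "is_basis P E V"
  obtains X where "X \<in> V" "struct_vec P E X = (\<chi> i. if i \<in> P then v $ i else 0)"
proof
  have V: "V = span (E ` P)" using bas by (simp add: is_basis_def)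
  let ?v = "\<chi> i. if i \<in> P then v $ i else 0"
  show "(\<Sum>i\<in>P. ?v $ i *\<^sub>R E i) \<in> V"
    unfolding V by (intro span_sum span_scale span_base imageI)
  show "struct_vec P E (\<Sum>i\<in>P. ?v $ i *\<^sub>R E i) = ?v"
    by (rule struct_vec_eqI[OF bas]) simp
qed

lemma basis_nonzero: "is_basis P E V \<Longrightarrow> i \<in> P \<Longrightarrow> E i \<noteq> 0"
  by (metis dependent_zero imageI is_basis_def)

lemma struct_D_injective:
  assumes "is_basis P E V" "struct_D P E *v v = 0"
  shows "v = 0"
proof -
  have "norm (column i (struct_Phi P E)) \<noteq> 0" if "i \<in> P" for i
  proof -
    have "column i (struct_Phi P E) = vec_stack (E i)"
      using that by (simp add: column_def struct_Phi_def vec_eq_iff)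
    then have "(norm (column i (struct_Phi P E)))\<^sup>2 = (norm (E i))\<^sup>2"
      by (simp add: norm_vec_stack_power2)
    then show ?thesis
      using basis_nonzero[OF assms(1) that] by auto
  qed
  then show ?thesis
    using assms(2) by (simp add: vec_eq_iff struct_D_def diag_matrix_mult_vec split: if_splits) metis
qed

text \<open>
  Applying the compatibility condition to \<open>E i + E j\<close> and \<open>E i - E j\<close> shows that
  \<open>\<bar>e + e'\<bar> = \<bar>e\<bar> + \<bar>e'\<bar> = \<bar>e - e'\<bar>\<close> for their entries \<open>e\<close>, \<open>e'\<close> at the same place, so one of them is 0.
\<close>

lemma abs_compatible_disjoint_supports:
  assumes bas: "is_basis P E V" and ac: "abs_compatible P E V"
    and ij: "i \<in> P" "j \<in> P" "i \<noteq> j"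
  shows "E i $ r $ c = 0 \<or> E j $ r $ c = 0"
proof -
  have *: "\<bar>E i $ r $ c + s * E j $ r $ c\<bar> = \<bar>E i $ r $ c\<bar> + \<bar>E j $ r $ c\<bar>"
    if s: "\<bar>s\<bar> = 1" for s :: real
  proof -
    define v where "v = (\<chi> l. if l = i then 1 else if l = j then s else 0)"
    define X where "X = (\<Sum>l\<in>P. v $ l *\<^sub>R E l)"
    have XV: "X \<in> V"
    proof -
      have V: "V = span (E ` P)" using bas by (simp add: is_basis_def)
      show ?thesis
        unfolding X_def V by (intro span_sum span_scale span_base imageI)
    qed
    have sv: "struct_vec P E X = v"
      unfolding X_def by (rule struct_vec_eqI[OF bas]) (use ij in \<open>auto simp: v_def\<close>)
    have sub: "(\<Sum>l\<in>P. h l) = h i + h j"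
      if "\<And>l. l \<noteq> i \<Longrightarrow> l \<noteq> j \<Longrightarrow> h l = 0" for h :: "'a \<Rightarrow> real^'b^'c"
    proof -
      have "(\<Sum>l\<in>P. h l) = (\<Sum>l\<in>{i, j}. h l)"
        by (rule sum.mono_neutral_right) (use ij that in auto)
      then show ?thesis using ij by simp
    qed
    have "X = E i + s *\<^sub>R E j"
      unfolding X_def by (subst sub) (use ij in \<open>auto simp: v_def\<close>)
    moreover have "\<bar>X\<bar> = \<bar>E i\<bar> + \<bar>E j\<bar>"
    proof -
      have "\<bar>X\<bar> = (\<Sum>l\<in>P. \<bar>v\<bar> $ l *\<^sub>R \<bar>E l\<bar>)"
        using ac XV by (simp add: abs_compatible_def sv)
      also have "\<dots> = \<bar>E i\<bar> + \<bar>E j\<bar>"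
        by (subst sub) (use ij s in \<open>auto simp: v_def abs_vec_def\<close>)
      finally show ?thesis .
    qed
    ultimately show ?thesis
      by (simp add: vec_eq_iff abs_vec_def)
  qed
  have "\<bar>E i $ r $ c + E j $ r $ c\<bar> = \<bar>E i $ r $ c\<bar> + \<bar>E j $ r $ c\<bar>"
    "\<bar>E i $ r $ c - E j $ r $ c\<bar> = \<bar>E i $ r $ c\<bar> + \<bar>E j $ r $ c\<bar>"
    using *[of 1] *[of "-1"] by simp_all
  then show ?thesis by linarith
qed

text \<open>Since the supports are disjoint, an entry in the support of \<open>E i\<close> sees only the coordinate \<open>i\<close>.\<close>

lemma abs_le_iff_struct_vec:
  assumes bas: "is_basis P E V" and ac: "abs_compatible P E V" and X: "X \<in> V" and Y: "Y \<in> V"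
  shows "\<bar>X\<bar> \<le> \<bar>Y\<bar> \<longleftrightarrow> \<bar>struct_vec P E X\<bar> \<le> \<bar>struct_vec P E Y\<bar>"
proof
  assume le: "\<bar>struct_vec P E X\<bar> \<le> \<bar>struct_vec P E Y\<bar>"
  have "(\<Sum>i\<in>P. \<bar>struct_vec P E X\<bar> $ i *\<^sub>R \<bar>E i\<bar>) \<le> (\<Sum>i\<in>P. \<bar>struct_vec P E Y\<bar> $ i *\<^sub>R \<bar>E i\<bar>)"
    using le by (auto simp: less_eq_vec_def abs_vec_def intro!: sum_mono mult_right_mono)
  then show "\<bar>X\<bar> \<le> \<bar>Y\<bar>"
    using ac X Y by (simp add: abs_compatible_def)
next
  assume le: "\<bar>X\<bar> \<le> \<bar>Y\<bar>"
  have "\<bar>struct_vec P E X $ i\<bar> \<le> \<bar>struct_vec P E Y $ i\<bar>" for i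
  proof (cases "i \<in> P")
    case True
    obtain r c where rc: "E i $ r $ c \<noteq> 0"
      using basis_nonzero[OF bas True] by (auto simp: vec_eq_iff)
    have entry: "\<bar>Z $ r $ c\<bar> = \<bar>struct_vec P E Z $ i\<bar> * \<bar>E i $ r $ c\<bar>" if "Z \<in> V" for Z
    proof -
      have "Z $ r $ c = (\<Sum>l\<in>P. struct_vec P E Z $ l * E l $ r $ c)"
        by (subst struct_vec_expansion(1)[OF bas that, symmetric]) simp
      also have "\<dots> = (\<Sum>l\<in>{i}. struct_vec P E Z $ l * E l $ r $ c)"
        by (rule sum.mono_neutral_right)
          (use True rc abs_compatible_disjoint_supports[OF bas ac True] in \<open>auto\<close>)
      finally show ?thesis by (simp add: abs_mult)
    qed
    have "\<bar>X $ r $ c\<bar> \<le> \<bar>Y $ r $ c\<bar>"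
      using le by (simp add: less_eq_vec_def abs_vec_def)
    then show ?thesis
      using rc by (simp add: entry X Y)
  next
    case False
    then show ?thesis by (simp add: struct_vec_expansion(2)[OF bas] X Y)
  qed
  then show "\<bar>struct_vec P E X\<bar> \<le> \<bar>struct_vec P E Y\<bar>"
    by (simp add: less_eq_vec_def abs_vec_def)
qed

section \<open>First-order perturbation of a linear system\<close>

lemma norm_matrix_vector_mult_le: "norm (U *v w) \<le> norm U * norm w" for U :: "real^'c^'r"
proof (rule power2_le_imp_le)
  have "(norm (U *v w))\<^sup>2 = (\<Sum>i\<in>UNIV. (U $ i \<bullet> w)\<^sup>2)"
    by (simp add: norm_vec_power2 matrix_vector_mult_def inner_vec_def)
  also have "\<dots> \<le> (\<Sum>i\<in>UNIV. (norm (U $ i))\<^sup>2 * (norm w)\<^sup>2)"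
    by (intro sum_mono) (metis Cauchy_Schwarz_ineq2 abs_ge_zero power2_abs power_mono power_mult_distrib)
  also have "\<dots> = (norm U * norm w)\<^sup>2"
    by (simp add: power_mult_distrib norm_vec_power2[of U] sum_distrib_right)
  finally show "(norm (U *v w))\<^sup>2 \<le> (norm U * norm w)\<^sup>2" .
qed simp

lemma matrix_inv_mult:
  assumes "invertible X"
  shows "X ** matrix_inv X = mat 1" "matrix_inv X ** X = mat 1"
  using someI_ex[OF assms[unfolded invertible_def]] by (auto simp: matrix_inv_def)

lemma invertible_iff_ker: "invertible X \<longleftrightarrow> (\<forall>v. X *v v = 0 \<longrightarrow> v = 0)" for X :: "real^'l^'l"
  by (simp add: invertible_left_inverse matrix_left_invertible_ker)

text \<open>
  Every supremum in question is taken over perturbations \<open>(\<eta> U, \<eta> u)\<close> where \<open>(U, u)\<close> ranges over a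
  bounded set \<open>Q\<close> that does not depend on \<open>\<eta>\<close>.  Writing the perturbation of the solution as
  \<open>\<eta> w\<close>, one has \<open>M w = u - U z - \<eta> U w\<close>, so that \<open>w\<close> differs from \<open>M\<^sup>-\<^sup>1 (u - U z)\<close> by
  \<open>O(\<eta>)\<close>, uniformly over \<open>Q\<close>.  Hence the suprema converge to the supremum \<open>s\<close> of the linearised
  problem.
\<close>

lemma condition_number_limit:
  fixes M :: "real^'l^'l" and rho :: "real^'l \<Rightarrow> real"
  assumes inv: "invertible M" and Mz: "M *v z = d"
    and bdd: "\<And>U u. Q U u \<Longrightarrow> norm U \<le> b \<and> norm u \<le> b"
    and rho: "\<And>v w. \<bar>rho v - rho w\<bar> \<le> L * norm (v - w)"
    and \<phi>: "\<And>\<eta>. \<eta> > 0 \<Longrightarrow>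
      \<phi> \<eta> = Sup {val \<eta> dz | dM dd dz. adm \<eta> dM dd \<and> perturbed_solution M d z dM dd dz}"
    and adm: "\<And>\<eta> U u. \<eta> > 0 \<Longrightarrow> adm \<eta> (\<eta> *\<^sub>R U) (\<eta> *\<^sub>R u) \<longleftrightarrow> Q U u"
    and val: "\<And>\<eta> w. \<eta> > 0 \<Longrightarrow> val \<eta> (\<eta> *\<^sub>R w) = ereal (rho w)"
    and lub: "\<And>t. (\<forall>U u. Q U u \<longrightarrow> rho (matrix_inv M *v (u - U *v z)) \<le> t) \<longleftrightarrow> s \<le> t"
  shows "(\<phi> \<longlongrightarrow> ereal s) (at_right 0)"
proof -
  define N where "N = matrix_inv M"
  \<comment> \<open>\<open>R\<close> bounds \<open>u - U z\<close>; for \<open>\<eta> < \<delta>\<close> the norm of \<open>\<eta> M\<^sup>-\<^sup>1 U\<close> is at most 1/2, so that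
    \<open>M + \<eta> U\<close> is invertible and \<open>w\<close> is bounded by \<open>2 c R\<close>; \<open>G \<eta>\<close> bounds the linearisation error\<close>
  define c where "c = norm N"
  define R where "R = b + b * norm z"
  define G where "G = \<bar>L\<bar> * (c * b * (2 * c * R))"
  define \<delta> where "\<delta> = 1 / (2 * (c * b + 1))"
  have NM: "N *v (M *v v) = v" and MN: "M *v (N *v v) = v" for v
    using matrix_inv_mult[OF inv] by (simp_all add: N_def matrix_vector_mul_assoc)
  \<comment> \<open>\<open>Q\<close> is nonempty, since the empty set has no least upper bound among the reals\<close>
  obtain U0 u0 where Q0: "Q U0 u0"
    using lub[of "s - 1"] by auto
  have b: "b \<ge> 0"
    using bdd[OF Q0] norm_ge_zero[of u0] by linarith
  have c: "c \<ge> 0" by (simp add: c_def)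
  have R: "R \<ge> 0" using b by (simp add: R_def)
  have cb: "c * b \<ge> 0" using b c by simp
  have \<delta>: "\<delta> > 0" using cb by (simp add: \<delta>_def)
  have small: "\<eta> * (c * b) \<le> 1/2" if "0 < \<eta>" "\<eta> < \<delta>" for \<eta>
  proof -
    have "\<eta> * (2 * (c * b + 1)) \<le> 1"
      using that cb by (simp add: \<delta>_def field_simps)
    then show ?thesis using that by (simp add: algebra_simps)
  qed
  have NU: "norm (N *v (U *v w)) \<le> (c * b) * norm w" if "Q U u" for U u w
  proof -
    have "norm (N *v (U *v w)) \<le> c * (norm U * norm w)"
      unfolding c_def by (meson norm_ge_zero mult_left_mono norm_matrix_vector_mult_le order_trans)
    also have "\<dots> \<le> c * (b * norm w)"
      using bdd[OF that] c by (intro mult_left_mono mult_right_mono) auto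
    finally show ?thesis by (simp add: mult_ac)
  qed
  have sol: "invertible (M + \<eta> *\<^sub>R U)"
    and eq: "perturbed_solution M d z (\<eta> *\<^sub>R U) (\<eta> *\<^sub>R u) (\<eta> *\<^sub>R w)
          \<Longrightarrow> \<bar>rho w - rho (N *v (u - U *v z))\<bar> \<le> G * \<eta>"
    if \<eta>: "0 < \<eta>" "\<eta> < \<delta>" and Q: "Q U u" for \<eta> U u w
  proof -
    have half: "norm (\<eta> *\<^sub>R (N *v (U *v w))) \<le> norm w / 2" for w
    proof -
      have "norm (\<eta> *\<^sub>R (N *v (U *v w))) \<le> \<eta> * ((c * b) * norm w)"
        using NU[OF Q, of w] \<eta> by simp
      also have "\<dots> = (\<eta> * (c * b)) * norm w" by simp
      also have "\<dots> \<le> 1/2 * norm w"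
        using small[OF \<eta>] by (intro mult_right_mono) auto
      finally show ?thesis by simp
    qed
    show "invertible (M + \<eta> *\<^sub>R U)"
      unfolding invertible_iff_ker
    proof (intro allI impI)
      fix w assume "(M + \<eta> *\<^sub>R U) *v w = 0"
      then have "M *v w = - (\<eta> *\<^sub>R (U *v w))"
        by (simp add: matrix_vector_mult_add_rdistrib scaleR_matrix_vector_assoc eq_neg_iff_add_eq_0)
      then have "w = N *v (- (\<eta> *\<^sub>R (U *v w)))"
        by (metis NM)
      also have "\<dots> = - (\<eta> *\<^sub>R (N *v (U *v w)))"
        by (simp add: matrix_vector_mult_scaleR flip: scaleR_minus_left)
      finally have "norm w = norm (\<eta> *\<^sub>R (N *v (U *v w)))"
        by (metis norm_minus_cancel)
      with half[of w] have "norm w \<le> 0" by linarith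
      then show "w = 0" by simp
    qed
    assume "perturbed_solution M d z (\<eta> *\<^sub>R U) (\<eta> *\<^sub>R u) (\<eta> *\<^sub>R w)"
    then have "(M + \<eta> *\<^sub>R U) *v (z + \<eta> *\<^sub>R w) = d + \<eta> *\<^sub>R u"
      by (simp add: perturbed_solution_def)
    then have "\<eta> *\<^sub>R (M *v w) = \<eta> *\<^sub>R (u - U *v z - \<eta> *\<^sub>R (U *v w))"
      by (simp add: matrix_vector_mult_add_rdistrib matrix_vector_right_distrib Mz
          matrix_vector_mult_scaleR scaleR_right_diff_distrib algebra_simps
          flip: scaleR_matrix_vector_assoc)
    then have "M *v w = (u - U *v z) - \<eta> *\<^sub>R (U *v w)"
      using \<eta> by simp
    then have "w = N *v ((u - U *v z) - \<eta> *\<^sub>R (U *v w))"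
      by (metis NM)
    then have w: "w = N *v (u - U *v z) - \<eta> *\<^sub>R (N *v (U *v w))"
      by (simp add: matrix_vector_mult_diff_distrib matrix_vector_mult_scaleR)
    have "norm (N *v (u - U *v z)) \<le> c * norm (u - U *v z)"
      unfolding c_def by (rule norm_matrix_vector_mult_le)
    also have "\<dots> \<le> c * R"
    proof (rule mult_left_mono)
      have "norm (U *v z) \<le> b * norm z"
        using bdd[OF Q] by (meson norm_ge_zero mult_right_mono norm_matrix_vector_mult_le order_trans)
      then show "norm (u - U *v z) \<le> R"
        using bdd[OF Q] norm_triangle_ineq4[of u "U *v z"] by (simp add: R_def)
    qed (rule c)
    finally have "norm w \<le> c * R + norm w / 2"
      using half[of w] norm_triangle_ineq4[of "N *v (u - U *v z)" "\<eta> *\<^sub>R (N *v (U *v w))"] w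
      by (metis add_mono order_trans)
    then have nw: "norm w \<le> 2 * c * R" by simp
    have "\<bar>rho w - rho (N *v (u - U *v z))\<bar> \<le> L * norm (w - N *v (u - U *v z))"
      by (rule rho)
    also have "\<dots> \<le> \<bar>L\<bar> * norm (w - N *v (u - U *v z))"
      by (intro mult_right_mono) auto
    also have "norm (w - N *v (u - U *v z)) = norm (\<eta> *\<^sub>R (N *v (U *v w)))"
      by (subst w) (simp add: norm_minus_commute)
    also have "\<bar>L\<bar> * \<dots> \<le> \<bar>L\<bar> * (\<eta> * ((c * b) * (2 * c * R)))"
    proof (intro mult_left_mono)
      have "norm (\<eta> *\<^sub>R (N *v (U *v w))) \<le> \<eta> * ((c * b) * norm w)"
        using NU[OF Q, of w] \<eta> by simp
      also have "\<dots> \<le> \<eta> * ((c * b) * (2 * c * R))"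
        using \<eta> nw cb by (intro mult_left_mono) auto
      finally show "norm (\<eta> *\<^sub>R (N *v (U *v w))) \<le> \<eta> * ((c * b) * (2 * c * R))" .
    qed simp
    finally show "\<bar>rho w - rho (N *v (u - U *v z))\<bar> \<le> G * \<eta>"
      by (simp add: G_def mult_ac)
  qed
  have upper: "\<phi> \<eta> \<le> ereal (s + G * \<eta>)" and lower: "ereal (s - G * \<eta>) \<le> \<phi> \<eta>"
    if \<eta>: "0 < \<eta>" "\<eta> < \<delta>" for \<eta>
  proof -
    show up: "\<phi> \<eta> \<le> ereal (s + G * \<eta>)"
      unfolding \<phi>[OF \<eta>(1)]
    proof (rule Sup_least, clarify)
      fix dM dd dz assume a: "adm \<eta> dM dd" and p: "perturbed_solution M d z dM dd dz"
      define U u w where "U = dM /\<^sub>R \<eta>" and "u = dd /\<^sub>R \<eta>" and "w = dz /\<^sub>R \<eta>"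
      have sc: "dM = \<eta> *\<^sub>R U" "dd = \<eta> *\<^sub>R u" "dz = \<eta> *\<^sub>R w"
        using \<eta> by (auto simp: U_def u_def w_def)
      have Q: "Q U u" using a \<eta> by (simp add: sc adm)
      have "rho w \<le> rho (N *v (u - U *v z)) + G * \<eta>"
        using eq[OF \<eta> Q, of w] p by (simp add: sc abs_le_iff)
      moreover have "rho (N *v (u - U *v z)) \<le> s"
        using lub[of s] Q by (simp add: N_def)
      ultimately show "val \<eta> dz \<le> ereal (s + G * \<eta>)"
        using \<eta> by (simp add: sc val)
    qed
    have member: "ereal (rho (N *v (u - U *v z)) - G * \<eta>) \<le> \<phi> \<eta>" if Q: "Q U u" for U u
    proof -
      define w where "w = (matrix_inv (M + \<eta> *\<^sub>R U) *v (d + \<eta> *\<^sub>R u) - z) /\<^sub>R \<eta>"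
      have "\<eta> *\<^sub>R w = matrix_inv (M + \<eta> *\<^sub>R U) *v (d + \<eta> *\<^sub>R u) - z"
        using \<eta> by (simp add: w_def)
      then have p: "perturbed_solution M d z (\<eta> *\<^sub>R U) (\<eta> *\<^sub>R u) (\<eta> *\<^sub>R w)"
        using sol[OF \<eta> Q] matrix_inv_mult(1)[OF sol[OF \<eta> Q]]
        by (simp add: perturbed_solution_def matrix_vector_mul_assoc)
      have "ereal (rho (N *v (u - U *v z)) - G * \<eta>) \<le> ereal (rho w)"
        using eq[OF \<eta> Q p] by (simp add: abs_le_iff)
      also have "\<dots> = val \<eta> (\<eta> *\<^sub>R w)" using \<eta> by (simp add: val)
      also have "\<dots> \<le> \<phi> \<eta>"
        unfolding \<phi>[OF \<eta>(1)] using p adm[OF \<eta>(1)] Q by (intro Sup_upper) blast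
      finally show ?thesis .
    qed
    obtain p where p: "\<phi> \<eta> = ereal p"
      using up member[OF Q0] by (cases "\<phi> \<eta>") auto
    have "\<forall>U u. Q U u \<longrightarrow> rho (N *v (u - U *v z)) \<le> p + G * \<eta>"
      using member unfolding p by fastforce
    then have "s \<le> p + G * \<eta>"
      using lub by (simp add: N_def)
    then show "ereal (s - G * \<eta>) \<le> \<phi> \<eta>"
      by (simp add: p)
  qed
  show ?thesis
  proof (rule tendsto_sandwich)
    show "\<forall>\<^sub>F \<eta> in at_right 0. ereal (s - G * \<eta>) \<le> \<phi> \<eta>"
      using lower \<delta> by (intro eventually_at_rightI[of 0 \<delta>]) auto
    show "\<forall>\<^sub>F \<eta> in at_right 0. \<phi> \<eta> \<le> ereal (s + G * \<eta>)"
      using upper \<delta> by (intro eventually_at_rightI[of 0 \<delta>]) auto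
    show "((\<lambda>\<eta>. ereal (s - G * \<eta>)) \<longlongrightarrow> ereal s) (at_right 0)"
      by (intro tendsto_ereal) (auto intro!: tendsto_eq_intros)
    show "((\<lambda>\<eta>. ereal (s + G * \<eta>)) \<longlongrightarrow> ereal s) (at_right 0)"
      by (intro tendsto_ereal) (auto intro!: tendsto_eq_intros)
  qed
qed

section \<open>The linearised extremal problems\<close>

text \<open>
  The coordinates of a structured saddle point matrix, in the order of the columns of
  \<^const>\<open>saddle_Phi\<close>; \<^const>\<open>saddle_absvec\<close> is their entrywise absolute value.
\<close>

definition saddle_vec ::
    "'p::finite set \<Rightarrow> ('p \<Rightarrow> real^'m^'m) \<Rightarrow> 's::finite set \<Rightarrow> ('s \<Rightarrow> real^'n^'n) \<Rightarrow>
     real^'m^'m \<Rightarrow> real^'m^'n \<Rightarrow> real^'m^'n \<Rightarrow> real^'n^'n \<Rightarrow>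
     real^('p + ((('m \<times> 'n) + ('m \<times> 'n)) + 's))" where
  "saddle_vec P E S F A B C D =
     vstack (struct_vec P E A)
       (vstack (vstack (vec_stack B) (vec_stack C)) (struct_vec S F D))"

lemma vec_stack_abs: "vec_stack \<bar>X\<bar> = \<bar>vec_stack X\<bar>" for X :: "real^'c^'r"
  by (simp add: vec_eq_iff vec_stack_def abs_vec_def)

lemma saddle_absvec_eq: "saddle_absvec P E S F A B C D = \<bar>saddle_vec P E S F A B C D\<bar>"
  by (simp add: saddle_absvec_def saddle_vec_def abs_vstack vec_stack_abs)

lemma diag_matrix_vstack: "block_diag (diag_matrix a) (diag_matrix b) = diag_matrix (vstack a b)"
  by (simp add: vec_eq_iff all_sum_type block_diag_def diag_matrix_def)

lemma saddle_structI:
  "A \<in> L1 \<Longrightarrow> D \<in> L2 \<Longrightarrow> saddle_matrix A B C D \<in> saddle_struct L1 L2"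
  by (auto simp: saddle_struct_def)

lemma norm_vstack_le:
  assumes "norm p \<le> norm p'"
  shows "norm (vstack p q) \<le> norm (vstack p' q)"
proof (rule power2_le_imp_le)
  show "(norm (vstack p q))\<^sup>2 \<le> (norm (vstack p' q))\<^sup>2"
    using assms by (simp add: norm_vstack_power2 power_mono)
qed simp

lemma matrix_vector_mult_minus_left: "(- X) *v v = - (X *v v)" for X :: "real^'c^'r"
  by (simp add: vec_eq_iff matrix_vector_mult_def sum_negf)

lemma mat_1_eq_diag_matrix: "mat 1 = diag_matrix 1"
  by (simp add: vec_eq_iff mat_def diag_matrix_def)

lemma saddle_D_diagonal: obtains \<delta> where "saddle_D P E S F = diag_matrix \<delta>"
  unfolding saddle_D_def struct_D_def mat_1_eq_diag_matrix diag_matrix_vstack by blast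

lemma infnorm_le_iff: "infnorm v \<le> t \<longleftrightarrow> (\<forall>i. \<bar>v $ i\<bar> \<le> t)" for v :: "real^'k"
proof
  assume "\<forall>i. \<bar>v $ i\<bar> \<le> t"
  then show "infnorm v \<le> t"
    unfolding infnorm_cart by (intro cSup_least) auto
qed (meson component_le_infnorm_cart order_trans)

text \<open>
  Bases of the spaces of the two diagonal blocks; the off-diagonal blocks are unstructured.
\<close>

locale saddle_structure =
  fixes P :: "'p::finite set" and E :: "'p \<Rightarrow> real^'m^'m"
    and S :: "'s::finite set" and F :: "'s \<Rightarrow> real^'n^'n"
    and L1 :: "(real^'m^'m) set" and L2 :: "(real^'n^'n) set"
  assumes basis1: "is_basis P E L1" and basis2: "is_basis S F L2"
begin

lemma saddle_H_Phi_mult: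
  assumes "A \<in> L1" "D \<in> L2"
  shows "saddle_H x y *v (saddle_Phi P E S F *v saddle_vec P E S F A B C D)
           = saddle_matrix A B C D *v vstack x y"
  using struct_Phi_mult_struct_vec[OF basis1 assms(1)] struct_Phi_mult_struct_vec[OF basis2 assms(2)]
  by (simp add: saddle_Phi_def saddle_vec_def block_diag_mult_vstack saddle_H_mult)

lemma norm_saddle_D_mult:
  assumes "frobenius_compatible P E L1" "frobenius_compatible S F L2" "A \<in> L1" "D \<in> L2"
  shows "norm (saddle_D P E S F *v saddle_vec P E S F A B C D) = norm (saddle_matrix A B C D)"
proof -
  have "(norm (saddle_D P E S F *v saddle_vec P E S F A B C D))\<^sup>2 = (norm (saddle_matrix A B C D))\<^sup>2"
    using assms
    by (simp add: saddle_D_def saddle_vec_def block_diag_mult_vstack norm_vstack_power2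
        norm_vec_stack_power2 norm_saddle_matrix_power2 frobenius_compatible_def)
  then show ?thesis by simp
qed

lemma abs_saddle_matrix_le_iff:
  assumes "abs_compatible P E L1" "abs_compatible S F L2" "A \<in> L1" "D \<in> L2" "A' \<in> L1" "D' \<in> L2"
  shows "\<bar>saddle_matrix A B C D\<bar> \<le> \<bar>saddle_matrix A' B' C' D'\<bar> \<longleftrightarrow>
    \<bar>saddle_vec P E S F A B C D\<bar> \<le> \<bar>saddle_vec P E S F A' B' C' D'\<bar>"
proof -
  have "\<bar>saddle_matrix A B C D\<bar> \<le> \<bar>saddle_matrix A' B' C' D'\<bar> \<longleftrightarrow>
      \<bar>A\<bar> \<le> \<bar>A'\<bar> \<and> \<bar>B\<bar> \<le> \<bar>B'\<bar> \<and> \<bar>C\<bar> \<le> \<bar>C'\<bar> \<and> \<bar>D\<bar> \<le> \<bar>D'\<bar>"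
    by (auto simp: less_eq_vec_def abs_vec_def saddle_matrix_def all_sum_type transpose_def)
  also have "\<dots> \<longleftrightarrow> \<bar>struct_vec P E A\<bar> \<le> \<bar>struct_vec P E A'\<bar> \<and> \<bar>B\<bar> \<le> \<bar>B'\<bar> \<and> \<bar>C\<bar> \<le> \<bar>C'\<bar> \<and>
      \<bar>struct_vec S F D\<bar> \<le> \<bar>struct_vec S F D'\<bar>"
    using assms by (simp add: abs_le_iff_struct_vec[OF basis1] abs_le_iff_struct_vec[OF basis2])
  also have "\<dots> \<longleftrightarrow> \<bar>saddle_vec P E S F A B C D\<bar> \<le> \<bar>saddle_vec P E S F A' B' C' D'\<bar>"
    by (auto simp: less_eq_vec_def abs_vec_def saddle_vec_def all_sum_type vec_stack_def)
  finally show ?thesis .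
qed

text \<open>
  Every coordinate vector represents a structured matrix, up to the padding coordinates, which
  \<^const>\<open>saddle_Phi\<close> annihilates.
\<close>

lemma saddle_vec_surj:
  obtains A D B C where "A \<in> L1" "D \<in> L2"
    "saddle_Phi P E S F *v saddle_vec P E S F A B C D = saddle_Phi P E S F *v v"
    "\<forall>i. saddle_vec P E S F A B C D $ i = v $ i \<or> saddle_vec P E S F A B C D $ i = 0"
proof -
  obtain p r where v: "v = vstack p r" by (rule vstack_cases)
  obtain bc q where r: "r = vstack bc q" by (rule vstack_cases)
  obtain b c where bc: "bc = vstack b c" by (rule vstack_cases)
  obtain B C where BC: "b = vec_stack B" "c = vec_stack C" by (meson vec_stack_cases)
  obtain A where A: "A \<in> L1" "struct_vec P E A = (\<chi> i. if i \<in> P then p $ i else 0)"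
    by (rule struct_vec_surj[OF basis1])
  obtain D where D: "D \<in> L2" "struct_vec S F D = (\<chi> i. if i \<in> S then q $ i else 0)"
    by (rule struct_vec_surj[OF basis2])
  show ?thesis
  proof
    show "saddle_Phi P E S F *v saddle_vec P E S F A B C D = saddle_Phi P E S F *v v"
      by (simp add: v r bc BC saddle_Phi_def saddle_vec_def block_diag_mult_vstack struct_Phi_mult A D)
    show "\<forall>i. saddle_vec P E S F A B C D $ i = v $ i \<or> saddle_vec P E S F A B C D $ i = 0"
      by (simp add: v r bc BC saddle_vec_def all_sum_type A D)
  qed (use A D in auto)
qed

lemma invertible_saddle_D: "invertible (saddle_D P E S F)"
  unfolding invertible_iff_ker
proof (intro allI impI)
  fix v assume v0: "saddle_D P E S F *v v = 0"
  obtain p r where v: "v = vstack p r" by (rule vstack_cases)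
  obtain bc q where r: "r = vstack bc q" by (rule vstack_cases)
  have "struct_D P E *v p = 0" "bc = 0" "struct_D S F *v q = 0"
    using v0 by (simp_all add: v r saddle_D_def block_diag_mult_vstack vstack_eq_0_iff)
  then show "v = 0"
    using struct_D_injective[OF basis1] struct_D_injective[OF basis2]
    unfolding v r vstack_eq_0_iff by blast
qed

text \<open>
  For a structured \<open>U\<close> with coordinates \<open>v\<close>, the vector \<open>u - U z\<close> is \<open>-[H \<Phi> \<DD>\<^sup>-\<^sup>1, -I]\<close> applied to
  \<open>(\<DD> v, u)\<close>, whose Euclidean norm is the Frobenius norm of \<open>[U u]\<close>.
\<close>

lemma normwise_linearised_sup:
  fixes R :: "real^('m + 'n)^'k"
  assumes fc: "frobenius_compatible P E L1" "frobenius_compatible S F L2" and N: "N > 0"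
  shows "(\<forall>U u. U \<in> saddle_struct L1 L2 \<and> norm (augmented U u) \<le> N \<longrightarrow>
            norm (R *v (u - U *v vstack x y)) \<le> t) \<longleftrightarrow>
    spectral_norm (R ** hstack (saddle_H x y ** saddle_Phi P E S F ** matrix_inv (saddle_D P E S F))
                     (- mat 1)) * N \<le> t"
    (is "?lhs \<longleftrightarrow> spectral_norm ?T * N \<le> t")
proof -
  let ?H = "saddle_H x y" and ?\<Phi> = "saddle_Phi P E S F" and ?\<DD> = "saddle_D P E S F"
  note inv\<DD> = matrix_inv_mult[OF invertible_saddle_D]
  have cancel: "(?H ** ?\<Phi> ** matrix_inv ?\<DD>) *v (?\<DD> *v v) = ?H *v (?\<Phi> *v v)" for v
  proof -
    have "matrix_inv ?\<DD> *v (?\<DD> *v v) = v"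
      by (simp add: matrix_vector_mul_assoc inv\<DD>)
    then show ?thesis
      by (simp flip: matrix_vector_mul_assoc)
  qed
  have T_mult: "?T *v vstack (?\<DD> *v v) u = R *v (?H *v (?\<Phi> *v v) - u)" for v u
    by (simp add: hstack_mult_vstack cancel matrix_vector_mult_minus_left
        flip: matrix_vector_mul_assoc[of R])
  have T: "R *v (u - saddle_matrix A B C D *v vstack x y)
           = - (?T *v vstack (?\<DD> *v saddle_vec P E S F A B C D) u)"
    if "A \<in> L1" "D \<in> L2" for A B C D u
    by (simp add: T_mult saddle_H_Phi_mult[OF that] matrix_vector_mult_diff_distrib)
  have norm_aug: "norm (vstack (?\<DD> *v saddle_vec P E S F A B C D) u)
      = norm (augmented (saddle_matrix A B C D) u)" if "A \<in> L1" "D \<in> L2" for A B C D u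
  proof -
    have "(norm (vstack (?\<DD> *v saddle_vec P E S F A B C D) u))\<^sup>2
        = (norm (augmented (saddle_matrix A B C D) u))\<^sup>2"
      by (simp add: norm_vstack_power2 norm_augmented_power2 norm_saddle_D_mult[OF fc that])
    then show ?thesis by simp
  qed
  show ?thesis
  proof
    assume le: "spectral_norm ?T * N \<le> t"
    have "norm (R *v (u - saddle_matrix A B C D *v vstack x y)) \<le> t"
      if "A \<in> L1" "D \<in> L2" "norm (augmented (saddle_matrix A B C D) u) \<le> N" for A B C D u
    proof -
      have "norm (R *v (u - saddle_matrix A B C D *v vstack x y))
            \<le> spectral_norm ?T * norm (augmented (saddle_matrix A B C D) u)"
        unfolding T[OF that(1,2)] norm_minus_cancel norm_aug[OF that(1,2), symmetric]
          spectral_norm_def by (rule onorm) simp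
      also have "\<dots> \<le> spectral_norm ?T * N"
        unfolding spectral_norm_def using that by (intro mult_left_mono onorm_pos_le) auto
      finally show ?thesis using le by simp
    qed
    then show ?lhs
      by (auto simp: saddle_struct_def)
  next
    assume lhs: ?lhs
    \<comment> \<open>removing the padding coordinates from \<open>v\<close> leaves \<open>\<Phi> v\<close> unchanged and does not increase the norm of
      the diagonal image \<open>\<DD> v\<close>, so arbitrary \<open>w = (\<DD> v, u)\<close> are covered\<close>
    have bound: "norm (?T *v w) \<le> t" if w: "norm w \<le> N" for w
    proof -
      obtain q u where qu: "w = vstack q u" by (rule vstack_cases)
      define v where "v = matrix_inv ?\<DD> *v q"
      have q: "q = ?\<DD> *v v"
        unfolding v_def by (simp add: inv\<DD> matrix_vector_mul_assoc)
      obtain A D B C where AD: "A \<in> L1" "D \<in> L2"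
        and \<Phi>: "?\<Phi> *v saddle_vec P E S F A B C D = ?\<Phi> *v v"
        and mask: "\<forall>i. saddle_vec P E S F A B C D $ i = v $ i \<or> saddle_vec P E S F A B C D $ i = 0"
        by (rule saddle_vec_surj[of v])
      let ?sv = "saddle_vec P E S F A B C D"
      obtain \<delta> where \<delta>: "?\<DD> = diag_matrix \<delta>" by (rule saddle_D_diagonal)
      have "norm (?\<DD> *v ?sv) \<le> norm q"
        unfolding q \<delta>
      proof (rule norm_le_componentwise_cart)
        show "norm ((diag_matrix \<delta> *v ?sv) $ i) \<le> norm ((diag_matrix \<delta> *v v) $ i)" for i
          using spec[OF mask, of i] unfolding diag_matrix_mult_vec by auto
      qed
      then have "norm (vstack (?\<DD> *v ?sv) u) \<le> norm w"
        by (simp add: qu norm_vstack_le)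
      then have "norm (augmented (saddle_matrix A B C D) u) \<le> N"
        using w norm_aug[OF AD] by simp
      then have "norm (R *v (u - saddle_matrix A B C D *v vstack x y)) \<le> t"
        using lhs saddle_structI[OF AD] by blast
      then have "norm (?T *v vstack (?\<DD> *v ?sv) u) \<le> t"
        by (simp add: T[OF AD])
      moreover have "?T *v vstack (?\<DD> *v ?sv) u = ?T *v w"
        by (simp add: qu q T_mult \<Phi>)
      ultimately show ?thesis by simp
    qed
    have "norm (?T *v w) \<le> (t / N) * norm w" for w
    proof (cases "w = 0")
      case False
      have "norm (?T *v ((N / norm w) *\<^sub>R w)) \<le> t"
        by (rule bound) (use N False in simp)
      then show ?thesis
        using N False by (simp add: matrix_vector_mult_scaleR field_simps)
    qed simp
    then have "spectral_norm ?T \<le> t / N"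
      unfolding spectral_norm_def by (rule onorm_le)
    then show "spectral_norm ?T * N \<le> t"
      using N by (simp add: field_simps)
  qed
qed

text \<open>
  In row \<open>k\<close> the triangle inequality becomes an equality when each coordinate of the perturbation
  has the largest admissible modulus and the sign of the coefficient it meets.  The weights \<open>c\<close>
  allow the entries to be scaled together or separately.
\<close>

lemma entrywise_linearised_sup:
  fixes R :: "real^('m + 'n)^'k"
  assumes ac: "abs_compatible P E L1" "abs_compatible S F L2" and AD: "A \<in> L1" "D \<in> L2"
  shows "(\<forall>U u. U \<in> saddle_struct L1 L2 \<and> \<bar>U\<bar> \<le> \<bar>saddle_matrix A B C D\<bar> \<and> \<bar>u\<bar> \<le> \<bar>d\<bar> \<longrightarrow>
            infnorm (diag_matrix c *v (R *v (u - U *v vstack x y))) \<le> t) \<longleftrightarrow>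
    infnorm (diag_matrix c *v (\<bar>R ** saddle_H x y ** saddle_Phi P E S F\<bar> *v saddle_absvec P E S F A B C D
                                + \<bar>R\<bar> *v \<bar>d\<bar>)) \<le> t"
    (is "?lhs \<longleftrightarrow> infnorm (diag_matrix c *v ?b) \<le> t")
proof -
  let ?T = "R ** saddle_H x y ** saddle_Phi P E S F" and ?a = "saddle_vec P E S F A B C D"
  have b: "?b $ k = (\<Sum>j\<in>UNIV. \<bar>?T $ k $ j\<bar> * \<bar>?a $ j\<bar>) + (\<Sum>j\<in>UNIV. \<bar>R $ k $ j\<bar> * \<bar>d $ j\<bar>)" for k
    by (simp add: matrix_vector_mult_def abs_vec_def saddle_absvec_eq)
  have b0: "?b $ k \<ge> 0" for k
    unfolding b by (intro add_nonneg_nonneg sum_nonneg) auto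
  have lin: "R *v (u - saddle_matrix A' B' C' D' *v vstack x y)
      = R *v u - ?T *v saddle_vec P E S F A' B' C' D'" if "A' \<in> L1" "D' \<in> L2" for A' B' C' D' u
    by (simp add: saddle_H_Phi_mult[OF that, symmetric] matrix_vector_mult_diff_distrib
        matrix_vector_mul_assoc matrix_mul_assoc)
  show ?thesis
  proof
    assume le: "infnorm (diag_matrix c *v ?b) \<le> t"
    have "infnorm (diag_matrix c *v (R *v (u - saddle_matrix A' B' C' D' *v vstack x y))) \<le> t"
      if AD': "A' \<in> L1" "D' \<in> L2" and leM: "\<bar>saddle_matrix A' B' C' D'\<bar> \<le> \<bar>saddle_matrix A B C D\<bar>"
        and u: "\<bar>u\<bar> \<le> \<bar>d\<bar>" for A' B' C' D' u
      unfolding infnorm_le_iff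
    proof
      fix k
      let ?v = "saddle_vec P E S F A' B' C' D'"
      have v: "\<bar>?v $ j\<bar> \<le> \<bar>?a $ j\<bar>" for j
        using leM abs_saddle_matrix_le_iff[OF ac AD' AD]
        by (simp add: less_eq_vec_def abs_vec_def)
      have u: "\<bar>u $ j\<bar> \<le> \<bar>d $ j\<bar>" for j
        using u by (simp add: less_eq_vec_def abs_vec_def)
      have "\<bar>(?T *v ?v) $ k\<bar> \<le> (\<Sum>j\<in>UNIV. \<bar>?T $ k $ j\<bar> * \<bar>?a $ j\<bar>)"
        unfolding matrix_vector_mult_def vec_lambda_beta
        by (rule sum_abs[THEN order_trans]) (auto simp: abs_mult intro!: sum_mono mult_left_mono v)
      moreover have "\<bar>(R *v u) $ k\<bar> \<le> (\<Sum>j\<in>UNIV. \<bar>R $ k $ j\<bar> * \<bar>d $ j\<bar>)"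
        unfolding matrix_vector_mult_def vec_lambda_beta
        by (rule sum_abs[THEN order_trans]) (auto simp: abs_mult intro!: sum_mono mult_left_mono u)
      ultimately have "\<bar>(R *v u - ?T *v ?v) $ k\<bar> \<le> ?b $ k"
        unfolding b vector_minus_component by linarith
      then have "\<bar>c $ k\<bar> * \<bar>(R *v u - ?T *v ?v) $ k\<bar> \<le> \<bar>c $ k\<bar> * \<bar>?b $ k\<bar>"
        using b0[of k] by (intro mult_left_mono) auto
      also have "\<dots> \<le> t"
        using le unfolding infnorm_le_iff diag_matrix_mult_vec abs_mult by blast
      finally show "\<bar>(diag_matrix c *v (R *v (u - saddle_matrix A' B' C' D' *v vstack x y))) $ k\<bar> \<le> t"
        by (simp only: lin[OF AD'] diag_matrix_mult_vec abs_mult)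
    qed
    then show ?lhs
      by (auto simp: saddle_struct_def)
  next
    assume lhs: ?lhs
    show "infnorm (diag_matrix c *v ?b) \<le> t"
      unfolding infnorm_le_iff
    proof
      fix k
      define u where "u = (\<chi> j. sgn (R $ k $ j) * \<bar>d $ j\<bar>)"
      define v where "v = (\<chi> j. - sgn (?T $ k $ j) * \<bar>?a $ j\<bar>)"
      obtain A' D' B' C' where AD': "A' \<in> L1" "D' \<in> L2"
        and \<Phi>: "saddle_Phi P E S F *v saddle_vec P E S F A' B' C' D' = saddle_Phi P E S F *v v"
        and mask: "\<forall>i. saddle_vec P E S F A' B' C' D' $ i = v $ i
                        \<or> saddle_vec P E S F A' B' C' D' $ i = 0"
        by (rule saddle_vec_surj[of v])
      have v: "\<bar>v $ j\<bar> \<le> \<bar>?a $ j\<bar>" for j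
        by (simp add: v_def abs_mult abs_sgn_eq)
      have "\<bar>saddle_vec P E S F A' B' C' D'\<bar> \<le> \<bar>?a\<bar>"
        unfolding less_eq_vec_def abs_vec_def vec_lambda_beta
        using mask v by (metis abs_ge_zero abs_zero)
      then have leM: "\<bar>saddle_matrix A' B' C' D'\<bar> \<le> \<bar>saddle_matrix A B C D\<bar>"
        using abs_saddle_matrix_le_iff[OF ac AD' AD] by blast
      have "\<bar>u\<bar> \<le> \<bar>d\<bar>"
        by (simp add: less_eq_vec_def abs_vec_def u_def abs_mult abs_sgn_eq)
      then have "infnorm (diag_matrix c *v (R *v (u - saddle_matrix A' B' C' D' *v vstack x y))) \<le> t"
        using lhs leM saddle_structI[OF AD'] by blast
      moreover have "R *v (u - saddle_matrix A' B' C' D' *v vstack x y) = R *v u - ?T *v v"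
        unfolding lin[OF AD'] by (simp add: \<Phi> flip: matrix_vector_mul_assoc)
      ultimately have "\<bar>c $ k * (R *v u - ?T *v v) $ k\<bar> \<le> t"
        by (simp add: infnorm_le_iff diag_matrix_mult_vec)
      moreover have "(R *v u - ?T *v v) $ k = ?b $ k"
      proof -
        have "(R *v u) $ k = (\<Sum>j\<in>UNIV. \<bar>R $ k $ j\<bar> * \<bar>d $ j\<bar>)"
          by (simp add: matrix_vector_mult_def u_def abs_sgn mult_ac)
        moreover have "(?T *v v) $ k = - (\<Sum>j\<in>UNIV. \<bar>?T $ k $ j\<bar> * \<bar>?a $ j\<bar>)"
          by (simp add: matrix_vector_mult_def v_def abs_sgn mult_ac sum_negf)
        ultimately show ?thesis
          unfolding b vector_minus_component by simp
      qed
      ultimately show "\<bar>(diag_matrix c *v ?b) $ k\<bar> \<le> t"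
        by (simp only: diag_matrix_mult_vec)
    qed
  qed
qed

end

section \<open>The condition numbers\<close>

lemma saddle_matrix_scaleR:
  "saddle_matrix (r *\<^sub>R A) (r *\<^sub>R B) (r *\<^sub>R C) (r *\<^sub>R D) = r *\<^sub>R saddle_matrix A B C D"
  by (simp add: vec_eq_iff all_sum_type saddle_matrix_def transpose_def)

lemma norm_augmented_bound: "norm U \<le> norm (augmented U u) \<and> norm u \<le> norm (augmented U u)"
  using power2_le_imp_le[of "norm U" "norm (augmented U u)"]
    power2_le_imp_le[of "norm u" "norm (augmented U u)"]
  by (simp add: norm_augmented_power2)

lemma abs_augmented_scaleR_le_iff:
  assumes "\<eta> > 0"
  shows "\<bar>augmented (\<eta> *\<^sub>R U) (\<eta> *\<^sub>R u)\<bar> \<le> \<eta> *\<^sub>R \<bar>augmented M d\<bar> \<longleftrightarrow> \<bar>U\<bar> \<le> \<bar>M\<bar> \<and> \<bar>u\<bar> \<le> \<bar>d\<bar>"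
proof -
  have "\<bar>augmented (\<eta> *\<^sub>R U) (\<eta> *\<^sub>R u)\<bar> \<le> \<eta> *\<^sub>R \<bar>augmented M d\<bar>
        \<longleftrightarrow> \<bar>augmented U u\<bar> \<le> \<bar>augmented M d\<bar>"
    using assms by (simp add: augmented_scaleR less_eq_vec_def abs_vec_def abs_mult)
  then show ?thesis by (simp add: abs_augmented_le_iff)
qed

lemma norm_le_if_abs_vec_le: "\<bar>u\<bar> \<le> \<bar>d\<bar> \<Longrightarrow> norm u \<le> norm d" for u d :: "real^'l"
  by (rule norm_le_componentwise_cart) (simp add: less_eq_vec_def abs_vec_def)

lemma norm_le_if_abs_matrix_le: "\<bar>U\<bar> \<le> \<bar>M\<bar> \<Longrightarrow> norm U \<le> norm M" for U M :: "real^'c^'r"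
  by (rule norm_le_componentwise_cart, rule norm_le_if_abs_vec_le)
    (simp add: less_eq_vec_def abs_vec_def)

lemma tendsto_Lim_at_right:
  fixes \<phi> :: "real \<Rightarrow> ereal"
  assumes "(\<phi> \<longlongrightarrow> l) (at_right 0)"
  shows "Lim (at_right 0) \<phi> = l"
  by (rule tendsto_Lim[OF trivial_limit_at_right_real assms])

context saddle_structure
begin

lemma saddle_struct_scaleR_iff:
  assumes "\<eta> \<noteq> 0"
  shows "\<eta> *\<^sub>R U \<in> saddle_struct L1 L2 \<longleftrightarrow> U \<in> saddle_struct L1 L2"
proof -
  have sub: "subspace L1" "subspace L2"
    using basis1 basis2 by (auto simp: is_basis_def)
  have *: "r *\<^sub>R V \<in> saddle_struct L1 L2" if V: "V \<in> saddle_struct L1 L2" for r V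
  proof -
    obtain A B C D where "V = saddle_matrix A B C D" "A \<in> L1" "D \<in> L2"
      using V by (auto simp: saddle_struct_def)
    then show ?thesis
      using sub by (simp add: saddle_structI subspace_scale flip: saddle_matrix_scaleR)
  qed
  show ?thesis
    using *[of U \<eta>] *[of "\<eta> *\<^sub>R U" "inverse \<eta>"] assms by auto
qed

lemma normwise_sup_limit:
  fixes K :: "real^('m + 'n)^'k"
  assumes fc: "frobenius_compatible P E L1" "frobenius_compatible S F L2"
    and inv: "invertible M" and Mz: "M *v vstack x y = d" and Kz: "K *v vstack x y \<noteq> 0"
  shows "(normwise_sup (saddle_struct L1 L2) K M d (vstack x y) \<longlongrightarrow>
    ereal (spectral_norm (K ** matrix_inv M **
              hstack (saddle_H x y ** saddle_Phi P E S F ** matrix_inv (saddle_D P E S F)) (- mat 1))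
           * norm (augmented M d) / norm (K *v vstack x y))) (at_right 0)"
proof (rule condition_number_limit[OF inv Mz,
      where Q = "\<lambda>U u. norm (augmented U u) \<le> norm (augmented M d) \<and> U \<in> saddle_struct L1 L2"
        and rho = "\<lambda>w. norm (K *v w) / norm (K *v vstack x y)"
        and L = "norm K / norm (K *v vstack x y)"
        and b = "norm (augmented M d)"
        and adm = "\<lambda>\<eta> dM dd. norm (augmented dM dd) \<le> \<eta> * norm (augmented M d) \<and>
                     dM \<in> saddle_struct L1 L2"
        and val = "\<lambda>\<eta> dz. ereal (norm (K *v dz) / (\<eta> * norm (K *v vstack x y)))"])
  have kz: "norm (K *v vstack x y) > 0" using Kz by simp
  have "vstack x y \<noteq> 0" using Kz by auto
  then have "M \<noteq> 0" using inv by (auto simp: invertible_iff_ker)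
  then have N: "norm (augmented M d) > 0"
    using norm_augmented_bound[of M d] by (metis less_le_trans zero_less_norm_iff)
  show "norm U \<le> norm (augmented M d) \<and> norm u \<le> norm (augmented M d)"
    if "norm (augmented U u) \<le> norm (augmented M d) \<and> U \<in> saddle_struct L1 L2" for U u
    using that norm_augmented_bound[of U u] by linarith
  show "\<bar>norm (K *v v) / norm (K *v vstack x y) - norm (K *v w) / norm (K *v vstack x y)\<bar>
        \<le> norm K / norm (K *v vstack x y) * norm (v - w)" for v w
  proof -
    have "\<bar>norm (K *v v) - norm (K *v w)\<bar> \<le> norm (K *v (v - w))"
      unfolding matrix_vector_mult_diff_distrib by (rule norm_triangle_ineq3)
    also have "\<dots> \<le> norm K * norm (v - w)" by (rule norm_matrix_vector_mult_le)
    finally show ?thesis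
      using kz by (simp add: divide_right_mono abs_divide flip: diff_divide_distrib)
  qed
  show "normwise_sup (saddle_struct L1 L2) K M d (vstack x y) \<eta> =
      Sup {ereal (norm (K *v dz) / (\<eta> * norm (K *v vstack x y))) | dM dd dz.
        (norm (augmented dM dd) \<le> \<eta> * norm (augmented M d) \<and> dM \<in> saddle_struct L1 L2) \<and>
        perturbed_solution M d (vstack x y) dM dd dz}" for \<eta>
    by (simp only: normwise_sup_def conj_assoc)
  show "norm (augmented (\<eta> *\<^sub>R U) (\<eta> *\<^sub>R u)) \<le> \<eta> * norm (augmented M d) \<and>
        \<eta> *\<^sub>R U \<in> saddle_struct L1 L2 \<longleftrightarrow>
      norm (augmented U u) \<le> norm (augmented M d) \<and> U \<in> saddle_struct L1 L2"
    if "\<eta> > 0" for \<eta> U u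
    using that by (simp add: augmented_scaleR saddle_struct_scaleR_iff)
  show "ereal (norm (K *v (\<eta> *\<^sub>R w)) / (\<eta> * norm (K *v vstack x y)))
      = ereal (norm (K *v w) / norm (K *v vstack x y))" if "\<eta> > 0" for \<eta> w
    using that by (simp add: matrix_vector_mult_scaleR)
  show "(\<forall>U u. norm (augmented U u) \<le> norm (augmented M d) \<and> U \<in> saddle_struct L1 L2 \<longrightarrow>
        norm (K *v (matrix_inv M *v (u - U *v vstack x y))) / norm (K *v vstack x y) \<le> t) \<longleftrightarrow>
      spectral_norm (K ** matrix_inv M **
              hstack (saddle_H x y ** saddle_Phi P E S F ** matrix_inv (saddle_D P E S F)) (- mat 1))
        * norm (augmented M d) / norm (K *v vstack x y) \<le> t" for t
    using normwise_linearised_sup[OF fc N, of "K ** matrix_inv M" x y "t * norm (K *v vstack x y)"]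
    by (simp only: pos_divide_le_eq[OF kz] matrix_vector_mul_assoc conj_commute)
qed

lemma entrywise_sup_limit:
  fixes K :: "real^('m + 'n)^'k"
  assumes ac: "abs_compatible P E L1" "abs_compatible S F L2" and AD: "A \<in> L1" "D \<in> L2"
    and M: "M = saddle_matrix A B C D" and inv: "invertible M" and Mz: "M *v vstack x y = d"
    and \<phi>: "\<And>\<eta>. \<eta> > 0 \<Longrightarrow>
      \<phi> \<eta> = Sup {ereal (infnorm (diag_matrix c *v (K *v dz)) / \<eta>) | dM dd dz.
        \<bar>augmented dM dd\<bar> \<le> \<eta> *\<^sub>R \<bar>augmented M d\<bar> \<and> dM \<in> saddle_struct L1 L2 \<and>
        perturbed_solution M d (vstack x y) dM dd dz}"
  shows "(\<phi> \<longlongrightarrow> ereal (infnorm (diag_matrix c *v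
      (\<bar>K ** matrix_inv M ** saddle_H x y ** saddle_Phi P E S F\<bar> *v saddle_absvec P E S F A B C D
        + \<bar>K ** matrix_inv M\<bar> *v \<bar>d\<bar>)))) (at_right 0)"
proof (rule condition_number_limit[OF inv Mz,
      where Q = "\<lambda>U u. U \<in> saddle_struct L1 L2 \<and> \<bar>U\<bar> \<le> \<bar>M\<bar> \<and> \<bar>u\<bar> \<le> \<bar>d\<bar>"
        and rho = "\<lambda>w. infnorm (diag_matrix c *v (K *v w))"
        and L = "norm (diag_matrix c) * norm K"
        and b = "max (norm M) (norm d)"
        and adm = "\<lambda>\<eta> dM dd. \<bar>augmented dM dd\<bar> \<le> \<eta> *\<^sub>R \<bar>augmented M d\<bar> \<and>
                     dM \<in> saddle_struct L1 L2"
        and val = "\<lambda>\<eta> dz. ereal (infnorm (diag_matrix c *v (K *v dz)) / \<eta>)"])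
  show "norm U \<le> max (norm M) (norm d) \<and> norm u \<le> max (norm M) (norm d)"
    if "U \<in> saddle_struct L1 L2 \<and> \<bar>U\<bar> \<le> \<bar>M\<bar> \<and> \<bar>u\<bar> \<le> \<bar>d\<bar>" for U u
    using that norm_le_if_abs_matrix_le[of U M] norm_le_if_abs_vec_le[of u d] by linarith
  show "\<bar>infnorm (diag_matrix c *v (K *v v)) - infnorm (diag_matrix c *v (K *v w))\<bar>
        \<le> norm (diag_matrix c) * norm K * norm (v - w)" for v w
  proof -
    have "\<bar>infnorm (diag_matrix c *v (K *v v)) - infnorm (diag_matrix c *v (K *v w))\<bar>
        \<le> infnorm (diag_matrix c *v (K *v (v - w)))"
      unfolding matrix_vector_mult_diff_distrib by (rule absdiff_infnorm)
    also have "\<dots> \<le> norm (diag_matrix c *v (K *v (v - w)))" by (rule infnorm_le_norm)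
    also have "\<dots> \<le> norm (diag_matrix c) * norm (K *v (v - w))"
      by (rule norm_matrix_vector_mult_le)
    also have "\<dots> \<le> norm (diag_matrix c) * (norm K * norm (v - w))"
      by (intro mult_left_mono norm_matrix_vector_mult_le) simp
    finally show ?thesis by (simp add: mult.assoc)
  qed
  show "\<phi> \<eta> = Sup {ereal (infnorm (diag_matrix c *v (K *v dz)) / \<eta>) | dM dd dz.
      (\<bar>augmented dM dd\<bar> \<le> \<eta> *\<^sub>R \<bar>augmented M d\<bar> \<and> dM \<in> saddle_struct L1 L2) \<and>
      perturbed_solution M d (vstack x y) dM dd dz}" if "\<eta> > 0" for \<eta>
    using \<phi>[OF that] by (simp only: conj_assoc)
  show "\<bar>augmented (\<eta> *\<^sub>R U) (\<eta> *\<^sub>R u)\<bar> \<le> \<eta> *\<^sub>R \<bar>augmented M d\<bar> \<and>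
        \<eta> *\<^sub>R U \<in> saddle_struct L1 L2 \<longleftrightarrow>
      U \<in> saddle_struct L1 L2 \<and> \<bar>U\<bar> \<le> \<bar>M\<bar> \<and> \<bar>u\<bar> \<le> \<bar>d\<bar>"
    if "\<eta> > 0" for \<eta> U u
    using that by (auto simp: abs_augmented_scaleR_le_iff saddle_struct_scaleR_iff)
  show "ereal (infnorm (diag_matrix c *v (K *v (\<eta> *\<^sub>R w))) / \<eta>)
      = ereal (infnorm (diag_matrix c *v (K *v w)))" if "\<eta> > 0" for \<eta> w
    using that by (simp add: matrix_vector_mult_scaleR infnorm_mul)
  show "(\<forall>U u. U \<in> saddle_struct L1 L2 \<and> \<bar>U\<bar> \<le> \<bar>M\<bar> \<and> \<bar>u\<bar> \<le> \<bar>d\<bar> \<longrightarrow>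
        infnorm (diag_matrix c *v (K *v (matrix_inv M *v (u - U *v vstack x y)))) \<le> t) \<longleftrightarrow>
      infnorm (diag_matrix c *v
        (\<bar>K ** matrix_inv M ** saddle_H x y ** saddle_Phi P E S F\<bar> *v saddle_absvec P E S F A B C D
          + \<bar>K ** matrix_inv M\<bar> *v \<bar>d\<bar>)) \<le> t" for t
    using entrywise_linearised_sup[OF ac AD, of B C d c "K ** matrix_inv M" x y t]
    unfolding M[symmetric] matrix_vector_mul_assoc[of K] .
qed

end

lemma infnorm_quot_eq:
  fixes w v :: "real^'k"
  assumes "\<And>i. v $ i \<noteq> 0"
  shows "infnorm_quot w v = ereal (infnorm (diag_matrix (\<chi> i. inverse (v $ i)) *v w))"
    (is "_ = ereal (infnorm ?q)")
proof -
  have q: "\<bar>entry_quot (w $ i) (v $ i)\<bar> = ereal \<bar>?q $ i\<bar>" for i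
    using assms by (simp add: entry_quot_def diag_matrix_mult_vec divide_inverse mult.commute)
  show ?thesis
    unfolding infnorm_quot_def q
  proof (rule SUP_eqI)
    fix t assume t: "\<And>i. i \<in> UNIV \<Longrightarrow> ereal \<bar>?q $ i\<bar> \<le> t"
    show "ereal (infnorm ?q) \<le> t"
    proof (cases t)
      case (real r)
      then show ?thesis using t by (simp add: infnorm_le_iff)
    qed (use t in auto)
  qed (simp add: component_le_infnorm_cart)
qed

lemma infnorm_diag_matrix_const:
  "infnorm (diag_matrix (\<chi> i. inverse r) *v w) = infnorm w / r" if "r > 0" for w :: "real^'k"
proof -
  have "diag_matrix (\<chi> i. inverse r) *v w = inverse r *\<^sub>R w"
    by (simp add: vec_eq_iff diag_matrix_mult_vec)
  then show ?thesis
    using that by (simp add: infnorm_mul divide_inverse mult.commute)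
qed

theorem theorem4p1:
  fixes A :: "real^'m^'m" and B C :: "real^'m^'n" and D :: "real^'n^'n"
    and x f :: "real^'m" and y g :: "real^'n"
    and K :: "real^('m + 'n)^'k"
    and L1 :: "(real^'m^'m) set" and L2 :: "(real^'n^'n) set"
    and P :: "'p::finite set" and E :: "'p \<Rightarrow> real^'m^'m"
    and S :: "'s::finite set" and F :: "'s \<Rightarrow> real^'n^'n"
  defines "M \<equiv> saddle_matrix A B C D"
    and "d \<equiv> vstack f g"
    and "z \<equiv> vstack x y"
    and "LL \<equiv> saddle_struct L1 L2"
    and "H \<equiv> saddle_H x y"
    and "\<Phi> \<equiv> saddle_Phi P E S F"
    and "\<DD> \<equiv> saddle_D P E S F"
    and "a \<equiv> saddle_absvec P E S F A B C D"
  assumes "subspace L1" and "is_basis P E L1"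
    and "subspace L2" and "is_basis S F L2"
    and "A \<in> L1" and "D \<in> L2"
    and "invertible A" and "invertible M"
    and "M *v z = d"
  shows
    "(frobenius_compatible P E L1 \<and> frobenius_compatible S F L2 \<and> K *v z \<noteq> 0 \<longrightarrow>
       (normwise_sup LL K M d z \<longlongrightarrow> normwise_cond LL K M d z) (at_right 0) \<and>
       normwise_cond LL K M d z =
         ereal (spectral_norm (K ** matrix_inv M ** hstack (H ** \<Phi> ** matrix_inv \<DD>) (- mat 1))
                * frobenius_norm (augmented M d) / norm (K *v z))) \<and>
     (abs_compatible P E L1 \<and> abs_compatible S F L2 \<and> z \<noteq> 0 \<and> K *v z \<noteq> 0 \<longrightarrow>
       (mixed_sup LL K M d z \<longlongrightarrow> mixed_cond LL K M d z) (at_right 0) \<and>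
       mixed_cond LL K M d z =
         ereal (infnorm (\<bar>K ** matrix_inv M ** H ** \<Phi>\<bar> *v a
                         + \<bar>K ** matrix_inv M\<bar> *v vstack \<bar>f\<bar> \<bar>g\<bar>) / infnorm (K *v z))) \<and>
     (abs_compatible P E L1 \<and> abs_compatible S F L2 \<and>
     (\<forall>i. x $ i \<noteq> 0) \<and> (\<forall>i. y $ i \<noteq> 0) \<and> (\<forall>i. (K *v z) $ i \<noteq> 0) \<longrightarrow>
       (componentwise_sup LL K M d z \<longlongrightarrow> componentwise_cond LL K M d z) (at_right 0) \<and>
       componentwise_cond LL K M d z =
         ereal (infnorm ((mp_inverse (diag_matrix (K *v z)) ** \<bar>K ** matrix_inv M ** H ** \<Phi>\<bar>) *v a
                         + (mp_inverse (diag_matrix (K *v z)) ** \<bar>K ** matrix_inv M\<bar>)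
                             *v vstack \<bar>f\<bar> \<bar>g\<bar>)))"
proof -
  interpret saddle_structure P E S F L1 L2
    by unfold_locales (use assms in auto)
  have Mz: "M *v vstack x y = d" and inv: "invertible M" and AD: "A \<in> L1" "D \<in> L2"
    and M: "M = saddle_matrix A B C D"
    using assms by auto
  have abs_d: "vstack \<bar>f\<bar> \<bar>g\<bar> = \<bar>d\<bar>"
    by (simp add: d_def abs_vstack)
  show ?thesis
  proof (intro conjI impI; elim conjE)
    assume fc: "frobenius_compatible P E L1" "frobenius_compatible S F L2" and Kz: "K *v z \<noteq> 0"
    note lim = normwise_sup_limit[OF fc inv Mz Kz[unfolded z_def],
        folded z_def LL_def H_def \<Phi>_def \<DD>_def]
    show eq: "normwise_cond LL K M d z =
         ereal (spectral_norm (K ** matrix_inv M ** hstack (H ** \<Phi> ** matrix_inv \<DD>) (- mat 1))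
                * frobenius_norm (augmented M d) / norm (K *v z))"
      unfolding normwise_cond_def by (rule tendsto_Lim_at_right[OF lim])
    show "(normwise_sup LL K M d z \<longlongrightarrow> normwise_cond LL K M d z) (at_right 0)"
      unfolding eq by (rule lim)
  next
    assume ac: "abs_compatible P E L1" "abs_compatible S F L2" and Kz: "K *v z \<noteq> 0"
    have kz: "infnorm (K *v z) > 0" using Kz by (simp add: infnorm_pos_lt)
    have sup: "mixed_sup LL K M d z \<eta> =
      Sup {ereal (infnorm (diag_matrix (\<chi> i. inverse (infnorm (K *v z))) *v (K *v dz)) / \<eta>) | dM dd dz.
        \<bar>augmented dM dd\<bar> \<le> \<eta> *\<^sub>R \<bar>augmented M d\<bar> \<and> dM \<in> LL \<and>
        perturbed_solution M d z dM dd dz}" for \<eta>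
      by (simp add: mixed_sup_def infnorm_diag_matrix_const[OF kz] mult.commute)
    note lim = entrywise_sup_limit[OF ac AD M inv Mz, folded z_def LL_def, OF sup,
        folded H_def \<Phi>_def a_def abs_d, unfolded infnorm_diag_matrix_const[OF kz]]
    show eq: "mixed_cond LL K M d z =
         ereal (infnorm (\<bar>K ** matrix_inv M ** H ** \<Phi>\<bar> *v a
                         + \<bar>K ** matrix_inv M\<bar> *v vstack \<bar>f\<bar> \<bar>g\<bar>) / infnorm (K *v z))"
      unfolding mixed_cond_def by (rule tendsto_Lim_at_right[OF lim])
    show "(mixed_sup LL K M d z \<longlongrightarrow> mixed_cond LL K M d z) (at_right 0)"
      unfolding eq by (rule lim)
  next
    assume ac: "abs_compatible P E L1" "abs_compatible S F L2" and Kz: "\<forall>i. (K *v z) $ i \<noteq> 0"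
    let ?c = "\<chi> i. inverse ((K *v z) $ i)"
    have sup: "componentwise_sup LL K M d z \<eta> =
      Sup {ereal (infnorm (diag_matrix ?c *v (K *v dz)) / \<eta>) | dM dd dz.
        \<bar>augmented dM dd\<bar> \<le> \<eta> *\<^sub>R \<bar>augmented M d\<bar> \<and> dM \<in> LL \<and>
        perturbed_solution M d z dM dd dz}" for \<eta>
      using Kz by (simp add: componentwise_sup_def infnorm_quot_eq)
    have mp: "mp_inverse (diag_matrix (K *v z)) = diag_matrix ?c"
      using Kz by (simp add: mp_inverse_diag_matrix)
    note lim = entrywise_sup_limit[OF ac AD M inv Mz, folded z_def LL_def, OF sup,
        folded H_def \<Phi>_def a_def abs_d,
        unfolded matrix_vector_right_distrib matrix_vector_mul_assoc, folded mp]
    show eq: "componentwise_cond LL K M d z =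
         ereal (infnorm ((mp_inverse (diag_matrix (K *v z)) ** \<bar>K ** matrix_inv M ** H ** \<Phi>\<bar>) *v a
                         + (mp_inverse (diag_matrix (K *v z)) ** \<bar>K ** matrix_inv M\<bar>)
                             *v vstack \<bar>f\<bar> \<bar>g\<bar>))"
      unfolding componentwise_cond_def by (rule tendsto_Lim_at_right[OF lim])
    show "(componentwise_sup LL K M d z \<longlongrightarrow> componentwise_cond LL K M d z) (at_right 0)"
      unfolding eq by (rule lim)
  qed
qed

end
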